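(* Let $p\in(0,\infty)$ with $p\neq2$, let $\mathfrak N$ be a finite factor, and let $U\in\mathscr U(\mathfrak N)$. Then $\|I-U\|_p^p+\|I+U\|_p^p=2^p$ if and only if $U=U^*$.
   Context: A finite factor is a von Neumann algebra factor admitting a (unique, faithful, normal) tracial state $\tau$, i.e. $M_n(\mathbb C)$ or a $\mathrm{II}_1$ factor. $\mathscr U(\mathfrak N)$ is the unitary group of $\mathfrak N$ and $\|A\|_p:=\tau(|A|^p)^{1/p}$ for $A\in\mathfrak N$. *)

theory Defs
  imports "HOL-Analysis.Analysis" "HOL-Computational_Algebra.Polynomial"
begin

text \<open>Complex Hilbert spaces. The inner product is linear in its first argument; the last axiom
  makes it positive definite and makes the norm of the type the induced one.\<close>

class chilbert_space = banach +
  fixes scaleC :: "complex \<Rightarrow> 'a \<Rightarrow> 'a" (infixr "*\<^sub>C" 75)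
    and cinner :: "'a \<Rightarrow> 'a \<Rightarrow> complex"
  assumes scaleC_add_right: "c *\<^sub>C (x + y) = c *\<^sub>C x + c *\<^sub>C y"
    and scaleC_add_left: "(c + d) *\<^sub>C x = c *\<^sub>C x + d *\<^sub>C x"
    and scaleC_scaleC: "c *\<^sub>C d *\<^sub>C x = (c * d) *\<^sub>C x"
    and scaleR_scaleC: "r *\<^sub>R x = complex_of_real r *\<^sub>C x"
    and cinner_add_left: "cinner (x + y) z = cinner x z + cinner y z"
    and cinner_scaleC_left: "cinner (c *\<^sub>C x) y = c * cinner x y"
    and cinner_commute: "cinner x y = cnj (cinner y x)"
    and cinner_self: "cinner x x = complex_of_real ((norm x)\<^sup>2)"

text \<open>The type of bounded linear maps consists of real-linear ones; \<open>cblin\<close> is the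
  subalgebra of the complex-linear ones.\<close>

definition cblin :: "('a::chilbert_space \<Rightarrow>\<^sub>L 'a) set" where
  "cblin = {A. \<forall>c x. blinfun_apply A (c *\<^sub>C x) = c *\<^sub>C blinfun_apply A x}"

text \<open>The scalar operator \<open>cI\<close>. The complex multiple \<open>cA\<close> of an operator is \<open>scalar_op c o\<^sub>L A\<close>.\<close>

definition scalar_op :: "complex \<Rightarrow> 'a::chilbert_space \<Rightarrow>\<^sub>L 'a" where
  "scalar_op c = Blinfun (\<lambda>x. c *\<^sub>C x)"

definition adj :: "('a::chilbert_space \<Rightarrow>\<^sub>L 'a) \<Rightarrow> 'a \<Rightarrow>\<^sub>L 'a" where
  "adj A = (THE B. \<forall>x y. cinner (blinfun_apply A x) y = cinner x (blinfun_apply B y))"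

definition commutant :: "('a::chilbert_space \<Rightarrow>\<^sub>L 'a) set \<Rightarrow> ('a \<Rightarrow>\<^sub>L 'a) set" where
  "commutant S = {A \<in> cblin. \<forall>B\<in>S. A o\<^sub>L B = B o\<^sub>L A}"

text \<open>Being equal to its bicommutant makes \<open>N\<close> a unital subalgebra.\<close>

definition von_neumann_algebra :: "('a::chilbert_space \<Rightarrow>\<^sub>L 'a) set \<Rightarrow> bool" where
  "von_neumann_algebra N \<longleftrightarrow>
     N \<subseteq> cblin \<and> (\<forall>A\<in>N. adj A \<in> N) \<and> commutant (commutant N) = N"

definition factor :: "('a::chilbert_space \<Rightarrow>\<^sub>L 'a) set \<Rightarrow> bool" where
  "factor N \<longleftrightarrow> von_neumann_algebra N \<and> N \<inter> commutant N = range scalar_op"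

definition unitary_group :: "('a::chilbert_space \<Rightarrow>\<^sub>L 'a) set \<Rightarrow> ('a \<Rightarrow>\<^sub>L 'a) set" where
  "unitary_group N = {U \<in> N. adj U o\<^sub>L U = id_blinfun \<and> U o\<^sub>L adj U = id_blinfun}"

definition tracial_state ::
  "('a::chilbert_space \<Rightarrow>\<^sub>L 'a) set \<Rightarrow> (('a \<Rightarrow>\<^sub>L 'a) \<Rightarrow> complex) \<Rightarrow> bool" where
  "tracial_state N \<tau> \<longleftrightarrow>
     (\<forall>A\<in>N. \<forall>B\<in>N. \<tau> (A + B) = \<tau> A + \<tau> B) \<and>
     (\<forall>c. \<forall>A\<in>N. \<tau> (scalar_op c o\<^sub>L A) = c * \<tau> A) \<and>
     (\<forall>A\<in>N. \<tau> (adj A o\<^sub>L A) \<in> \<real>\<^sub>\<ge>\<^sub>0) \<and>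
     \<tau> id_blinfun = 1 \<and>
     (\<forall>A\<in>N. \<forall>B\<in>N. \<tau> (A o\<^sub>L B) = \<tau> (B o\<^sub>L A))"

definition faithful_state ::
  "('a::chilbert_space \<Rightarrow>\<^sub>L 'a) set \<Rightarrow> (('a \<Rightarrow>\<^sub>L 'a) \<Rightarrow> complex) \<Rightarrow> bool" where
  "faithful_state N \<tau> \<longleftrightarrow> (\<forall>A\<in>N. \<tau> (adj A o\<^sub>L A) = 0 \<longrightarrow> A = 0)"

definition op_le :: "('a::chilbert_space \<Rightarrow>\<^sub>L 'a) \<Rightarrow> ('a \<Rightarrow>\<^sub>L 'a) \<Rightarrow> bool" where
  "op_le A B \<longleftrightarrow> (\<forall>x. cinner (blinfun_apply (B - A) x) x \<in> \<real>\<^sub>\<ge>\<^sub>0)"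

text \<open>Normality: compatibility with least upper bounds of upward directed sets of self-adjoint
  elements of \<open>N\<close> (equivalently, of bounded increasing nets).\<close>

definition normal_state ::
  "('a::chilbert_space \<Rightarrow>\<^sub>L 'a) set \<Rightarrow> (('a \<Rightarrow>\<^sub>L 'a) \<Rightarrow> complex) \<Rightarrow> bool" where
  "normal_state N \<tau> \<longleftrightarrow>
     (\<forall>D S. D \<subseteq> {A \<in> N. adj A = A} \<and> D \<noteq> {} \<and>
        (\<forall>A\<in>D. \<forall>B\<in>D. \<exists>C\<in>D. op_le A C \<and> op_le B C) \<and>
        S \<in> N \<and> adj S = S \<and> (\<forall>A\<in>D. op_le A S) \<and>
        (\<forall>T\<in>N. adj T = T \<and> (\<forall>A\<in>D. op_le A T) \<longrightarrow> op_le S T)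
      \<longrightarrow> Re (\<tau> S) = (SUP A\<in>D. Re (\<tau> A)))"

definition faithful_normal_tracial_state ::
  "('a::chilbert_space \<Rightarrow>\<^sub>L 'a) set \<Rightarrow> (('a \<Rightarrow>\<^sub>L 'a) \<Rightarrow> complex) \<Rightarrow> bool" where
  "faithful_normal_tracial_state N \<tau> \<longleftrightarrow>
     tracial_state N \<tau> \<and> faithful_state N \<tau> \<and> normal_state N \<tau>"

definition finite_factor :: "('a::chilbert_space \<Rightarrow>\<^sub>L 'a) set \<Rightarrow> bool" where
  "finite_factor N \<longleftrightarrow> factor N \<and> (\<exists>\<tau>. faithful_normal_tracial_state N \<tau>)"

definition spectrum :: "('a::chilbert_space \<Rightarrow>\<^sub>L 'a) \<Rightarrow> complex set" where
  "spectrum A = {l. \<not> (\<exists>B\<in>cblin. B o\<^sub>L (A - scalar_op l) = id_blinfun \<and>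
                                    (A - scalar_op l) o\<^sub>L B = id_blinfun)}"

definition op_poly :: "real poly \<Rightarrow> ('a::chilbert_space \<Rightarrow>\<^sub>L 'a) \<Rightarrow> 'a \<Rightarrow>\<^sub>L 'a" where
  "op_poly q A = (\<Sum>i\<le>degree q. coeff q i *\<^sub>R (((o\<^sub>L) A ^^ i) id_blinfun))"

text \<open>Continuous functional calculus \<open>f(A)\<close> for self-adjoint \<open>A\<close> and real \<open>f\<close> continuous on the
  (real) spectrum of \<open>A\<close>: the norm limit of \<open>q\<^sub>n(A)\<close> for polynomials \<open>q\<^sub>n\<close> converging to \<open>f\<close>
  uniformly on the spectrum.\<close>

definition cfc :: "(real \<Rightarrow> real) \<Rightarrow> ('a::chilbert_space \<Rightarrow>\<^sub>L 'a) \<Rightarrow> 'a \<Rightarrow>\<^sub>L 'a" where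
  "cfc f A = (THE B. \<forall>q :: nat \<Rightarrow> real poly.
     uniform_limit {t. complex_of_real t \<in> spectrum A} (\<lambda>n. poly (q n)) f sequentially
       \<longrightarrow> (\<lambda>n. op_poly (q n) A) \<longlonglongrightarrow> B)"

definition abs_op :: "('a::chilbert_space \<Rightarrow>\<^sub>L 'a) \<Rightarrow> 'a \<Rightarrow>\<^sub>L 'a" where
  "abs_op A = cfc sqrt (adj A o\<^sub>L A)"

definition pnorm ::
  "(('a::chilbert_space \<Rightarrow>\<^sub>L 'a) \<Rightarrow> complex) \<Rightarrow> real \<Rightarrow> ('a \<Rightarrow>\<^sub>L 'a) \<Rightarrow> real" where
  "pnorm \<tau> p A = Re (\<tau> (cfc (\<lambda>t. t powr p) (abs_op A))) powr (1 / p)"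

end

theory Submission
  imports Defs "HOL-Computational_Algebra.Fundamental_Theorem_Algebra"
begin

text \<open>Put \<open>H = |I - U|\<^sup>2\<close>. Then \<open>0 \<le> H \<le> 4\<close> and \<open>|I + U|\<^sup>2 = 4 - H\<close>, so with the positive
  functional \<open>L(f) = \<tau>(f(H))\<close> on continuous functions on \<open>[0, 4]\<close> the identity says that \<open>L\<close>
  vanishes at \<open>h(t) = t\<^bsup>p/2\<^esup> + (4 - t)\<^bsup>p/2\<^esup> - 2\<^bsup>p\<^esup>\<close>. For \<open>p \<noteq> 2\<close> this function has constant sign
  and exactly the zeros \<open>0\<close> and \<open>4\<close>, like \<open>w(t) = t (4 - t)\<close>, so \<open>L(h) = 0\<close> if and only if
  \<open>L(w) = 0\<close>. But \<open>w(H) = (U - U\<^sup>*)\<^sup>* (U - U\<^sup>*)\<close>, so by faithfulness \<open>L(w) = 0\<close> means \<open>U = U\<^sup>*\<close>.\<close>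

section \<open>Complex Hilbert spaces\<close>

text \<open>Both absolute values are functions of the one operator \<open>H\<close>, which is 2
  minus \<open>U\<close> minus its adjoint, so the noncommutative identity becomes a statement about
  one positive functional on continuous functions on the interval from 0 to 4. No spectral measure
  enters: agreement of zero sets is turned into domination of one function by a multiple of the
  other plus a small constant. At p = 2 the function h vanishes identically, whence the excluded
  exponent. The obstacle is that \<open>adj\<close> and \<open>cfc\<close> are definite descriptions
  and say nothing before a unique witness is known. For \<open>adj\<close> this is Riesz
  representation. For \<open>cfc\<close> it is the estimate of the norm of q(A) by the supremum of
  |q| on the spectrum of a self-adjoint A, which yields both convergence and independence of the
  approximating polynomials. That estimate rests on the norm, up to sign, being a spectral value,
  and this in turn on coercive operators being invertible.\<close>

lemma cinner_add_right: "cinner x (y + z) = cinner x y + cinner x (z :: 'a::chilbert_space)"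
  by (metis cinner_add_left cinner_commute complex_cnj_add)

lemma cinner_scaleC_right: "cinner x (c *\<^sub>C y) = cnj c * cinner x (y :: 'a::chilbert_space)"
  by (metis cinner_scaleC_left cinner_commute complex_cnj_mult)

lemma scaleC_one: "1 *\<^sub>C x = (x :: 'a::chilbert_space)"
  using scaleR_scaleC[of 1 x] by simp

lemma cinner_scaleR_left: "cinner (r *\<^sub>R x) y = of_real r * cinner (x :: 'a::chilbert_space) y"
  by (simp add: scaleR_scaleC cinner_scaleC_left)

lemma cinner_scaleR_right: "cinner x (r *\<^sub>R y) = of_real r * cinner (x :: 'a::chilbert_space) y"
  by (simp add: scaleR_scaleC cinner_scaleC_right)

lemma cinner_minus_left: "cinner (- x) y = - cinner (x :: 'a::chilbert_space) y"
  using cinner_scaleR_left[of "-1" x y] by simp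

lemma cinner_minus_right: "cinner x (- y) = - cinner (x :: 'a::chilbert_space) y"
  using cinner_scaleR_right[of x "-1" y] by simp

lemma cinner_diff_left: "cinner (x - y) z = cinner x z - cinner y (z :: 'a::chilbert_space)"
  using cinner_add_left[of x "- y" z] by (simp add: cinner_minus_left)

lemma cinner_diff_right: "cinner x (y - z) = cinner x y - cinner x (z :: 'a::chilbert_space)"
  using cinner_add_right[of x y "- z"] by (simp add: cinner_minus_right)

lemmas cinner_simps =
  cinner_add_left cinner_add_right cinner_diff_left cinner_diff_right cinner_minus_left
  cinner_minus_right cinner_scaleC_left cinner_scaleC_right cinner_scaleR_left cinner_scaleR_right

lemma Re_cinner_commute: "Re (cinner x y) = Re (cinner y (x :: 'a::chilbert_space))"
  by (metis cinner_commute complex_cnj(1) complex.sel(1) complex_surj)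

lemma norm_scaleC: "norm (c *\<^sub>C x) = cmod c * norm (x :: 'a::chilbert_space)"
proof -
  have "complex_of_real ((norm (c *\<^sub>C x))\<^sup>2) = c * cnj c * complex_of_real ((norm x)\<^sup>2)"
    using cinner_self[of "c *\<^sub>C x"] cinner_self[of x]
    by (simp add: cinner_scaleC_left cinner_scaleC_right mult_ac)
  also have "\<dots> = complex_of_real ((cmod c * norm x)\<^sup>2)"
    by (simp add: complex_mult_cnj cmod_power2 power_mult_distrib)
  finally have "(norm (c *\<^sub>C x))\<^sup>2 = (cmod c * norm x)\<^sup>2"
    using of_real_eq_iff by blast
  then show ?thesis
    by (simp add: power2_eq_iff_nonneg)
qed

lemma norm_add_square:
  "(norm (x + y))\<^sup>2 = (norm x)\<^sup>2 + 2 * Re (cinner x y) + (norm (y :: 'a::chilbert_space))\<^sup>2"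
proof -
  have "complex_of_real ((norm (x + y))\<^sup>2) =
      complex_of_real ((norm x)\<^sup>2) + (cinner x y + cinner y x) + complex_of_real ((norm y)\<^sup>2)"
    using cinner_self[of "x + y"] cinner_self[of x] cinner_self[of y]
    by (simp add: cinner_simps add_ac)
  then have "Re (complex_of_real ((norm (x + y))\<^sup>2)) =
      Re (complex_of_real ((norm x)\<^sup>2) + (cinner x y + cinner y x) + complex_of_real ((norm y)\<^sup>2))"
    by simp
  then show ?thesis
    using Re_cinner_commute[of x y] by simp
qed

lemma norm_diff_square:
  "(norm (x - y))\<^sup>2 = (norm x)\<^sup>2 - 2 * Re (cinner x y) + (norm (y :: 'a::chilbert_space))\<^sup>2"
  using norm_add_square[of x "- y"] by (simp add: cinner_minus_right)

text \<open>The usual order is reversed: the norm of the type already satisfies the triangle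
  inequality, and expanding its square gives Cauchy-Schwarz.\<close>

lemma Re_cinner_le: "Re (cinner x y) \<le> norm x * norm (y :: 'a::chilbert_space)"
proof -
  have "(norm (x + y))\<^sup>2 \<le> (norm x + norm y)\<^sup>2"
    by (simp add: norm_triangle_ineq)
  then show ?thesis
    by (simp add: norm_add_square power2_sum)
qed

lemma norm_cinner_le: "cmod (cinner x y) \<le> norm x * norm (y :: 'a::chilbert_space)"
proof (cases "cinner x y = 0")
  case False
  \<comment> \<open>A phase that rotates the inner product onto the nonnegative real axis, so that
    the bound on real parts suffices.\<close>
  define k where "k = cnj (sgn (cinner x y))"
  have "cmod k = 1"
    using False by (simp add: k_def norm_sgn)
  moreover have "k * cinner x y = of_real (cmod (cinner x y))"
    using False by (simp add: k_def sgn_eq field_simps flip: complex_norm_square power2_eq_square)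
  ultimately show ?thesis
    using Re_cinner_le[of "k *\<^sub>C x" y] by (simp add: cinner_simps norm_scaleC)
qed simp

lemma cinner_zero [simp]: "cinner 0 y = 0" "cinner x 0 = (0 :: complex)" for x y :: "'a::chilbert_space"
  using cinner_scaleR_left[of 0 0 y] cinner_scaleR_right[of x 0 0] by simp_all

lemma cinner_ext:
  fixes x y :: "'a::chilbert_space"
  assumes "\<And>v. cinner v x = cinner v y"
  shows "x = y"
proof -
  have "cinner (x - y) (x - y) = 0"
    using assms[of "x - y"] by (simp add: cinner_diff_right)
  then show ?thesis
    by (simp add: cinner_self)
qed

text \<open>Over the reals the sesquilinear form is bilinear; this supplies its continuity in all
  later limits.\<close>

lemma bounded_bilinear_cinner:
  "bounded_bilinear (cinner :: 'a::chilbert_space \<Rightarrow> 'a \<Rightarrow> complex)"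
proof
  show "\<exists>K. \<forall>a b. cmod (cinner a b) \<le> norm a * norm (b :: 'a) * K"
    by (intro exI[of _ 1]) (simp add: norm_cinner_le)
qed (simp_all add: cinner_simps scaleR_conv_of_real)

text \<open>If \<open>z\<close> represents \<open>g\<close>, then
  \<open>(norm x)\<^sup>2 - 2 * g x\<close> equals the squared distance from \<open>x\<close> to
  \<open>z\<close> up to a constant. So \<open>z\<close> is sought as a minimiser: the parallelogram
  law makes a minimising sequence Cauchy, and the vanishing first variation at the limit returns
  \<open>g\<close>.\<close>

lemma Riesz_real:
  fixes g :: "'a::chilbert_space \<Rightarrow> real"
  assumes g: "bounded_linear g"
  obtains z where "\<And>x. g x = Re (cinner x z)"
proof -
  interpret g: bounded_linear g by (rule g)
  define \<phi> where "\<phi> = (\<lambda>x. (norm x)\<^sup>2 - 2 * g x)"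
  define d where "d = Inf (range \<phi>)"
  obtain K where K: "\<And>x. \<bar>g x\<bar> \<le> norm x * K"
    using g.bounded by auto
  have "- K\<^sup>2 \<le> \<phi> x" for x
  proof -
    have "0 \<le> (norm x - K)\<^sup>2" by simp
    then show ?thesis
      using K[of x] by (simp add: \<phi>_def power2_diff abs_le_iff)
  qed
  then have bdd: "bdd_below (range \<phi>)"
    by (intro bdd_belowI2)
  have d_le: "d \<le> \<phi> x" for x
    unfolding d_def by (rule cInf_lower[OF _ bdd]) simp
  have "\<exists>x. \<phi> x < d + inverse (real (Suc n))" for n
    using cInf_less_iff[OF _ bdd, of "d + inverse (real (Suc n))"] by (auto simp: d_def)
  then obtain X where X: "\<And>n. \<phi> (X n) < d + inverse (real (Suc n))"
    by metis
  \<comment> \<open>Parallelogram law; the value of \<open>\<phi>\<close> at the midpoint of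
    \<open>x\<close> and \<open>y\<close> is at least \<open>d\<close>.\<close>
  have par: "(norm (x - y))\<^sup>2 \<le> 2 * (\<phi> x - d) + 2 * (\<phi> y - d)" for x y
  proof -
    have "(norm ((1/2) *\<^sub>R (x + y)))\<^sup>2 = (norm (x + y))\<^sup>2 / 4"
      by (simp add: power_divide)
    then have "(norm (x - y))\<^sup>2 = 2 * \<phi> x + 2 * \<phi> y - 4 * \<phi> ((1/2) *\<^sub>R (x + y))"
      unfolding \<phi>_def
      by (simp add: norm_add_square norm_diff_square g.add g.scaleR power_divide field_simps)
    then show ?thesis
      using d_le[of "(1/2) *\<^sub>R (x + y)"] by simp
  qed
  have "Cauchy X"
  proof (rule metric_CauchyI)
    fix e :: real
    assume "0 < e"
    then obtain M where M: "inverse (real (Suc M)) < e\<^sup>2 / 4"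
      using reals_Archimedean[of "e\<^sup>2 / 4"] by auto
    have near: "\<phi> (X m) < d + e\<^sup>2 / 4" if "m \<ge> M" for m
    proof -
      have "inverse (real (Suc m)) \<le> inverse (real (Suc M))"
        using that by (auto intro!: le_imp_inverse_le)
      then have "d + inverse (real (Suc m)) < d + e\<^sup>2 / 4"
        using M by (intro add_strict_left_mono) (rule le_less_trans)
      then show ?thesis
        by (rule less_trans[OF X])
    qed
    have "dist (X m) (X n) < e" if "m \<ge> M" "n \<ge> M" for m n
    proof -
      have "(norm (X m - X n))\<^sup>2 < e\<^sup>2"
        by (rule le_less_trans[OF par]) (use near[OF that(1)] near[OF that(2)] in argo)
      then show ?thesis
        using \<open>0 < e\<close> by (simp add: dist_norm power2_less_imp_less)
    qed
    then show "\<exists>M. \<forall>m\<ge>M. \<forall>n\<ge>M. dist (X m) (X n) < e"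
      by blast
  qed
  then obtain z where z: "X \<longlonglongrightarrow> z"
    using Cauchy_convergent_iff convergent_def by blast
  have "(\<lambda>n. \<phi> (X n)) \<longlonglongrightarrow> \<phi> z"
    unfolding \<phi>_def by (intro tendsto_intros g.tendsto z)
  moreover have "(\<lambda>n. d + inverse (real (Suc n))) \<longlonglongrightarrow> d + 0"
    by (intro tendsto_intros LIMSEQ_inverse_real_of_nat)
  ultimately have "\<phi> z \<le> d + 0"
    by (rule LIMSEQ_le) (use X less_imp_le in blast)
  then have min: "\<phi> z \<le> \<phi> x" for x
    using d_le[of x] by simp
  have "g v = Re (cinner v z)" for v
  proof -
    \<comment> \<open>\<open>e\<close> is the failure of representation at \<open>v\<close>. Moving
      from \<open>z\<close> by \<open>- u *\<^sub>R v\<close> would lower \<open>\<phi>\<close> by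
      \<open>u\<^sup>2 * (n + 2)\<close>, which minimality permits only for \<open>u = 0\<close>.
      The 1 in \<open>n + 1\<close> keeps the quotient meaningful at \<open>v = 0\<close>.\<close>
    define e where "e = Re (cinner z v) - g v"
    define n where "n = (norm v)\<^sup>2"
    define u where "u = e / (n + 1)"
    have n: "0 \<le> n" by (simp add: n_def)
    then have e: "e = u * (n + 1)" by (simp add: u_def)
    have "0 \<le> u\<^sup>2 * n - 2 * u * e"
      using min[of "z - u *\<^sub>R v"]
      by (simp add: \<phi>_def norm_diff_square g.diff g.scaleR e_def n_def cinner_simps
          power_mult_distrib algebra_simps)
    also have "u\<^sup>2 * n - 2 * u * e = - (u\<^sup>2 * (n + 2))"
      by (simp add: e power2_eq_square algebra_simps)
    finally have "u\<^sup>2 * (n + 2) \<le> 0"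
      by simp
    then have "u = 0"
      using n by (simp add: mult_le_0_iff)
    then have "e = 0"
      by (simp add: e)
    then show ?thesis
      using Re_cinner_commute[of z v] by (simp add: e_def)
  qed
  then show thesis by (rule that)
qed

section \<open>Complex-linear operators and adjoints\<close>

lemma cblin_scaleC: "A \<in> cblin \<Longrightarrow> blinfun_apply A (c *\<^sub>C x) = c *\<^sub>C blinfun_apply A x"
  by (simp add: cblin_def)

lemma adjoint_exists:
  fixes A :: "'a::chilbert_space \<Rightarrow>\<^sub>L 'a"
  assumes A: "A \<in> cblin"
  obtains B where "B \<in> cblin" "\<And>x y. cinner (blinfun_apply A x) y = cinner x (blinfun_apply B y)"
proof -
  have "\<exists>z. \<forall>x. cinner (blinfun_apply A x) y = cinner x z" for y
  proof -
    have "bounded_linear (\<lambda>x. Re (cinner (blinfun_apply A x) y))"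
      by (intro bounded_linear_compose[OF bounded_linear_Re]
          bounded_linear_compose[OF bounded_bilinear.bounded_linear_left[OF bounded_bilinear_cinner]]
          blinfun.bounded_linear_right)
    then obtain z where z: "\<And>x. Re (cinner (blinfun_apply A x) y) = Re (cinner x z)"
      by (rule Riesz_real) blast
    have "cinner (blinfun_apply A x) y = cinner x z" for x
    proof (rule complex_eqI)
      \<comment> \<open>Up to sign, the imaginary part at \<open>x\<close> is the real part at
        \<open>\<i> *\<^sub>C x\<close>; here complex linearity of \<open>A\<close> enters.\<close>
      show "Im (cinner (blinfun_apply A x) y) = Im (cinner x z)"
        using z[of "\<i> *\<^sub>C x"] by (simp add: cblin_scaleC[OF A] cinner_simps)
    qed (rule z)
    then show ?thesis by blast
  qed
  then obtain F where F: "\<And>x y. cinner (blinfun_apply A x) y = cinner x (F y)"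
    by metis
  have add: "F (y + z) = F y + F z" for y z
    by (rule cinner_ext) (simp add: F[symmetric] cinner_simps)
  have scaleC: "F (c *\<^sub>C y) = c *\<^sub>C F y" for c y
    by (rule cinner_ext) (simp add: F[symmetric] cinner_simps)
  have bound: "norm (F y) \<le> norm y * norm A" for y
  proof (cases "F y = 0")
    case False
    have "(norm (F y))\<^sup>2 = Re (cinner (blinfun_apply A (F y)) y)"
      by (simp add: F cinner_self)
    also have "\<dots> \<le> norm A * norm (F y) * norm y"
      by (rule order_trans[OF Re_cinner_le]) (simp add: mult_right_mono norm_blinfun)
    finally have "norm (F y) * norm (F y) \<le> norm (F y) * (norm y * norm A)"
      by (simp add: power2_eq_square mult_ac)
    then show ?thesis
      using False by simp
  qed simp
  have "bounded_linear F"
    using add scaleC bound by (intro bounded_linear_intro) (auto simp: scaleR_scaleC)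
  then have app: "blinfun_apply (Blinfun F) = F"
    by (rule bounded_linear_Blinfun_apply)
  show thesis
    by (rule that[of "Blinfun F"]) (simp_all add: app F scaleC cblin_def)
qed

lemma adj_eqI:
  fixes A B :: "'a::chilbert_space \<Rightarrow>\<^sub>L 'a"
  assumes "\<And>x y. cinner (blinfun_apply A x) y = cinner x (blinfun_apply B y)"
  shows "adj A = B"
  unfolding adj_def
proof (rule the_equality)
  fix C
  assume "\<forall>x y. cinner (blinfun_apply A x) y = cinner x (blinfun_apply C y)"
  then show "C = B"
    using assms by (intro blinfun_eqI cinner_ext) metis
qed (use assms in blast)

lemma cinner_adj:
  "A \<in> cblin \<Longrightarrow> cinner (blinfun_apply A x) y = cinner x (blinfun_apply (adj A) y)"
  using adjoint_exists[of A] adj_eqI by metis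

lemma scalar_op_apply [simp]: "blinfun_apply (scalar_op c) x = c *\<^sub>C (x :: 'a::chilbert_space)"
proof -
  have "bounded_linear (\<lambda>x :: 'a. c *\<^sub>C x)"
    by (rule bounded_linear_intro[where K = "cmod c"])
      (simp_all add: scaleC_add_right scaleR_scaleC scaleC_scaleC norm_scaleC mult.commute)
  then show ?thesis
    by (simp add: scalar_op_def bounded_linear_Blinfun_apply)
qed

lemma scaleC_zero_right [simp]: "c *\<^sub>C 0 = (0 :: 'a::chilbert_space)"
  using scaleC_add_right[of c 0 0] by simp

lemma scaleC_minus_left: "(- c) *\<^sub>C x = - (c *\<^sub>C (x :: 'a::chilbert_space))"
  using scaleC_add_left[of c "- c" x] scaleR_scaleC[of 0 x] by (simp add: eq_neg_iff_add_eq_0 add.commute)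

lemma scaleC_diff_right: "c *\<^sub>C (x - y) = c *\<^sub>C x - c *\<^sub>C (y :: 'a::chilbert_space)"
  by (metis scaleC_add_right diff_add_cancel add_diff_cancel_right')

lemma cblin_closed:
  "scalar_op c \<in> cblin" "id_blinfun \<in> cblin" "0 \<in> cblin"
  "A \<in> cblin \<Longrightarrow> B \<in> cblin \<Longrightarrow> A + B \<in> cblin"
  "A \<in> cblin \<Longrightarrow> B \<in> cblin \<Longrightarrow> A - B \<in> cblin"
  "A \<in> cblin \<Longrightarrow> B \<in> cblin \<Longrightarrow> A o\<^sub>L B \<in> cblin"
  "A \<in> cblin \<Longrightarrow> r *\<^sub>R A \<in> cblin"
  by (auto simp: cblin_def scaleC_scaleC blinfun.bilinear_simps scaleC_add_right scaleC_diff_right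
      scaleR_scaleC mult.commute)

lemma scalar_op_of_real: "scalar_op (complex_of_real r) = r *\<^sub>R id_blinfun"
  by (rule blinfun_eqI) (simp add: blinfun.bilinear_simps scaleR_scaleC)

lemma scalar_op_0 [simp]: "scalar_op 0 = 0"
  using scalar_op_of_real[of 0] by simp

lemma scalar_op_compose_of_real: "scalar_op (complex_of_real r) o\<^sub>L A = r *\<^sub>R A"
  by (rule blinfun_eqI) (simp add: blinfun.bilinear_simps scaleR_scaleC)


section \<open>Invertibility and spectrum\<close>

text \<open>The condition inside \<open>spectrum\<close> with the shift removed, so that it applies
  to products and polynomials.\<close>

definition cinvertible :: "('a::chilbert_space \<Rightarrow>\<^sub>L 'a) \<Rightarrow> bool" where
  "cinvertible A \<longleftrightarrow> (\<exists>B\<in>cblin. B o\<^sub>L A = id_blinfun \<and> A o\<^sub>L B = id_blinfun)"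

lemma in_spectrum_iff: "l \<in> spectrum A \<longleftrightarrow> \<not> cinvertible (A - scalar_op l)"
  by (simp add: spectrum_def cinvertible_def)

lemma cinvertible_compose:
  assumes "cinvertible A" "cinvertible B"
  shows "cinvertible (A o\<^sub>L B)"
proof -
  obtain A' B' where A': "A' \<in> cblin" "A' o\<^sub>L A = id_blinfun" "A o\<^sub>L A' = id_blinfun"
    and B': "B' \<in> cblin" "B' o\<^sub>L B = id_blinfun" "B o\<^sub>L B' = id_blinfun"
    using assms by (auto simp: cinvertible_def)
  have "\<And>x. A' (A x) = x" "\<And>x. A (A' x) = x" "\<And>x. B' (B x) = x" "\<And>x. B (B' x) = x"
    using A' B' by (metis blinfun_apply_blinfun_compose blinfun_apply_id_blinfun id_apply)+
  then have "(B' o\<^sub>L A') o\<^sub>L (A o\<^sub>L B) = id_blinfun" "(A o\<^sub>L B) o\<^sub>L (B' o\<^sub>L A') = id_blinfun"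
    by (auto intro!: blinfun_eqI)
  then show ?thesis
    using A'(1) B'(1) cblin_closed(6) unfolding cinvertible_def by blast
qed

text \<open>The Lax--Milgram argument: \<open>P x = y\<close> is solved by the fixed point of the map
  \<open>x \<mapsto> x - s k (P x - y)\<close>, which is a contraction for small \<open>s > 0\<close>.\<close>

lemma cinvertible_coercive:
  fixes P :: "'a::chilbert_space \<Rightarrow>\<^sub>L 'a"
  assumes P: "P \<in> cblin" and c: "0 < c" and k: "k \<noteq> 0"
    and coercive: "\<And>x. c * (norm x)\<^sup>2 \<le> Re (k * cinner (blinfun_apply P x) x)"
  shows "cinvertible P"
proof -
  \<comment> \<open>Multiplication by \<open>k\<close> turns the numerical range of \<open>P\<close>
    into the right half plane. The later uses take \<open>k\<close> to be 1, -1 or plus or minus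
    \<open>\<i>\<close>.\<close>
  define Q where "Q = scalar_op k o\<^sub>L P"
  have Q_apply: "blinfun_apply Q x = k *\<^sub>C blinfun_apply P x" for x
    by (simp add: Q_def)
  define M where "M = norm Q"
  \<comment> \<open>The squared contraction factor is at most
    \<open>1 - 2*s*c + s\<^sup>2 * M\<^sup>2\<close>. This \<open>s\<close> gives
    \<open>s * M\<^sup>2 \<le> c\<close>, which reduces it to \<open>1 - s*c\<close>, and the
    summand \<open>c\<^sup>2\<close> ensures both \<open>s * c \<le> 1\<close> and a positive
    denominator when \<open>M = 0\<close>.\<close>
  define s where "s = c / (M\<^sup>2 + c\<^sup>2)"
  have pos: "0 < M\<^sup>2 + c\<^sup>2"
    using c by (simp add: add_nonneg_pos)
  have s: "0 < s"
    using c pos by (simp add: s_def)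
  have sc: "s * c \<le> 1"
    using pos by (simp add: s_def power2_eq_square divide_le_eq)
  have sM: "s * M\<^sup>2 \<le> c"
    using c pos by (simp add: s_def divide_le_eq algebra_simps)
  have contr: "(norm (d - s *\<^sub>R blinfun_apply Q d))\<^sup>2 \<le> (1 - s * c) * (norm d)\<^sup>2" for d
  proof -
    have "(norm (blinfun_apply Q d))\<^sup>2 \<le> (M * norm d)\<^sup>2"
      unfolding M_def by (intro power_mono norm_blinfun) simp
    then have "s\<^sup>2 * (norm (blinfun_apply Q d))\<^sup>2 \<le> s\<^sup>2 * (M\<^sup>2 * (norm d)\<^sup>2)"
      by (intro mult_left_mono) (simp_all add: power_mult_distrib)
    also have "\<dots> = (s * M\<^sup>2) * (s * (norm d)\<^sup>2)"
      by (simp add: power2_eq_square)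
    also have "\<dots> \<le> c * (s * (norm d)\<^sup>2)"
      using s sM by (intro mult_right_mono) simp_all
    finally have 1: "s\<^sup>2 * (norm (blinfun_apply Q d))\<^sup>2 \<le> s * c * (norm d)\<^sup>2"
      by (simp add: mult_ac)
    have "c * (norm d)\<^sup>2 \<le> Re (cinner d (blinfun_apply Q d))"
      using coercive[of d] Re_cinner_commute[of d "blinfun_apply Q d"]
      by (simp add: Q_apply cinner_simps)
    then have 2: "s * (c * (norm d)\<^sup>2) \<le> s * Re (cinner d (blinfun_apply Q d))"
      using s by (intro mult_left_mono) simp_all
    have "(norm (d - s *\<^sub>R blinfun_apply Q d))\<^sup>2 =
        (norm d)\<^sup>2 - 2 * (s * Re (cinner d (blinfun_apply Q d))) + s\<^sup>2 * (norm (blinfun_apply Q d))\<^sup>2"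
      by (simp add: norm_diff_square cinner_simps power_mult_distrib)
    also have "\<dots> \<le> (norm d)\<^sup>2 - 2 * (s * (c * (norm d)\<^sup>2)) + s * c * (norm d)\<^sup>2"
      using 1 2 by linarith
    finally show ?thesis
      by (simp add: algebra_simps)
  qed
  have "\<exists>x. blinfun_apply P x = y" for y
  proof -
    define f where "f = (\<lambda>x. x - s *\<^sub>R (blinfun_apply Q x - k *\<^sub>C y))"
    have "dist (f x) (f x') \<le> sqrt (1 - s * c) * dist x x'" for x x'
    proof -
      have "f x - f x' = (x - x') - s *\<^sub>R blinfun_apply Q (x - x')"
        by (simp add: f_def blinfun.diff_right scaleR_diff_right)
      then have "dist (f x) (f x') = sqrt ((norm ((x - x') - s *\<^sub>R blinfun_apply Q (x - x')))\<^sup>2)"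
        by (simp add: dist_norm)
      also have "\<dots> \<le> sqrt ((1 - s * c) * (norm (x - x'))\<^sup>2)"
        by (rule real_sqrt_le_mono[OF contr])
      finally show ?thesis
        by (simp add: real_sqrt_mult dist_norm)
    qed
    then have "\<exists>!x. f x = x"
      using s c sc by (intro banach_fix_type[of "sqrt (1 - s * c)"]) simp_all
    then obtain x where "f x = x" by blast
    then have "k *\<^sub>C blinfun_apply P x = k *\<^sub>C y"
      using s by (simp add: f_def Q_apply)
    then have "inverse k *\<^sub>C k *\<^sub>C blinfun_apply P x = inverse k *\<^sub>C k *\<^sub>C y"
      by simp
    then show ?thesis
      using k by (auto simp: scaleC_scaleC scaleC_one)
  qed
  then obtain G where G: "\<And>y. blinfun_apply P (G y) = y"
    by metis
  \<comment> \<open>Coercivity bounds \<open>P\<close> from below. This gives injectivity, hence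
    linearity of the chosen right inverse \<open>G\<close>, and also the bound on
    \<open>G\<close>.\<close>
  have lower: "norm x \<le> norm (blinfun_apply P x) * (cmod k / c)" for x
  proof (cases "x = 0")
    case False
    have "c * (norm x)\<^sup>2 \<le> Re (cinner (k *\<^sub>C blinfun_apply P x) x)"
      using coercive by (simp add: cinner_simps)
    also have "\<dots> \<le> cmod k * norm (blinfun_apply P x) * norm x"
      using Re_cinner_le[of "k *\<^sub>C blinfun_apply P x" x] by (simp add: norm_scaleC)
    finally have "c * norm x \<le> cmod k * norm (blinfun_apply P x)"
      using False by (simp add: power2_eq_square)
    then show ?thesis
      using c by (simp add: field_simps)
  qed simp
  have inj: "x = y" if "blinfun_apply P x = blinfun_apply P y" for x y
    using lower[of "x - y"] that by (simp add: blinfun.diff_right)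
  have G_P: "G (blinfun_apply P x) = x" for x
    by (rule inj) (rule G)
  have add: "G (x + y) = G x + G y" for x y
    by (rule inj) (simp add: G blinfun.add_right)
  have scaleC: "G (a *\<^sub>C x) = a *\<^sub>C G x" for a x
    by (rule inj) (simp add: G cblin_scaleC[OF P])
  have "bounded_linear G"
  proof (rule bounded_linear_intro)
    show "norm (G x) \<le> norm x * (cmod k / c)" for x
      using lower[of "G x"] by (simp add: G)
  qed (simp_all add: add scaleC scaleR_scaleC)
  then have app: "blinfun_apply (Blinfun G) = G"
    by (rule bounded_linear_Blinfun_apply)
  show ?thesis
    unfolding cinvertible_def
  proof (intro bexI[of _ "Blinfun G"] conjI)
    show "Blinfun G \<in> cblin"
      by (simp add: cblin_def app scaleC)
  qed (auto intro!: blinfun_eqI simp: app G G_P)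
qed

section \<open>Spectra of self-adjoint operators\<close>

definition selfadj :: "('a::chilbert_space \<Rightarrow>\<^sub>L 'a) \<Rightarrow> bool" where
  "selfadj A \<longleftrightarrow> A \<in> cblin \<and>
     (\<forall>x y. cinner (blinfun_apply A x) y = cinner x (blinfun_apply A y))"

lemma selfadj_cblin: "selfadj A \<Longrightarrow> A \<in> cblin"
  by (simp add: selfadj_def)

lemma selfadj_cinner:
  "selfadj A \<Longrightarrow> cinner (blinfun_apply A x) y = cinner x (blinfun_apply A y)"
  by (simp add: selfadj_def)

text \<open>\<open>selfadj\<close> states symmetry through the inner product to stay clear of the
  definite description; this is the bridge back to \<open>adj\<close>.\<close>

lemma adj_selfadj: "selfadj A \<Longrightarrow> adj A = A"
  by (rule adj_eqI) (simp add: selfadj_cinner)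

lemma selfadj_cinner_real:
  assumes "selfadj A"
  shows "Im (cinner (blinfun_apply A x) x) = 0"
proof -
  have "cinner (blinfun_apply A x) x = cnj (cinner (blinfun_apply A x) x)"
    using selfadj_cinner[OF assms, of x x] cinner_commute[of x "blinfun_apply A x"] by simp
  then show ?thesis
    by (metis Reals_cnj_iff complex_is_Real_iff)
qed

text \<open>The quadratic form of \<open>A - l\<close> has imaginary part
  \<open>- Im l * (norm x)\<^sup>2\<close>, so multiplying by \<open>\<i>\<close> times the sign of
  \<open>Im l\<close> makes it coercive.\<close>

lemma selfadj_spectrum_real:
  assumes A: "selfadj A" and l: "l \<in> spectrum A"
  shows "Im l = 0"
proof (rule ccontr)
  assume "Im l \<noteq> 0"
  have "cinvertible (A - scalar_op l)"
  proof (rule cinvertible_coercive)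
    show "A - scalar_op l \<in> cblin"
      by (intro cblin_closed selfadj_cblin A)
    show "0 < \<bar>Im l\<bar>" "\<i> * of_real (sgn (Im l)) \<noteq> 0"
      using \<open>Im l \<noteq> 0\<close> by (simp_all add: sgn_if)
    show "\<bar>Im l\<bar> * (norm x)\<^sup>2 \<le>
        Re (\<i> * of_real (sgn (Im l)) * cinner (blinfun_apply (A - scalar_op l) x) x)" for x
      using selfadj_cinner_real[OF A, of x]
      by (simp add: blinfun.diff_left cinner_simps cinner_self abs_sgn mult_ac)
  qed
  then show False
    using l by (simp add: in_spectrum_iff)
qed

text \<open>For real \<open>t\<close> outside the interval, \<open>A - t\<close> or its negative is
  coercive, with constant the distance from \<open>t\<close> to the nearer endpoint.\<close>

lemma selfadj_spectrum_Icc: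
  assumes A: "selfadj A"
    and lower: "\<And>x. a * (norm x)\<^sup>2 \<le> Re (cinner (blinfun_apply A x) x)"
    and upper: "\<And>x. Re (cinner (blinfun_apply A x) x) \<le> b * (norm x)\<^sup>2"
  shows "spectrum A \<subseteq> complex_of_real ` {a..b}"
proof
  fix l
  assume l: "l \<in> spectrum A"
  define t where "t = Re l"
  have lt: "l = of_real t"
    using selfadj_spectrum_real[OF A l] by (simp add: t_def complex_eq_iff)
  have cb: "A - scalar_op l \<in> cblin"
    by (intro cblin_closed selfadj_cblin A)
  have "\<not> t < a"
  proof
    assume "t < a"
    have "cinvertible (A - scalar_op l)"
    proof (rule cinvertible_coercive[OF cb, where k = 1 and c = "a - t"])
      show "(a - t) * (norm x)\<^sup>2 \<le> Re (1 * cinner (blinfun_apply (A - scalar_op l) x) x)" for x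
        using lower[of x] by (simp add: lt blinfun.diff_left cinner_simps cinner_self algebra_simps)
    qed (use \<open>t < a\<close> in simp_all)
    then show False using l by (simp add: in_spectrum_iff)
  qed
  moreover have "\<not> b < t"
  proof
    assume "b < t"
    have "cinvertible (A - scalar_op l)"
    proof (rule cinvertible_coercive[OF cb, where k = "-1" and c = "t - b"])
      show "(t - b) * (norm x)\<^sup>2 \<le> Re (- 1 * cinner (blinfun_apply (A - scalar_op l) x) x)" for x
        using upper[of x] by (simp add: lt blinfun.diff_left cinner_simps cinner_self algebra_simps)
    qed (use \<open>b < t\<close> in simp_all)
    then show False using l by (simp add: in_spectrum_iff)
  qed
  ultimately show "l \<in> complex_of_real ` {a..b}"
    using lt by auto
qed

text \<open>This takes the place of the spectral radius formula. Write \<open>M\<close> for the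
  norm. If \<open>T - M\<close> and \<open>T + M\<close> were both invertible, so would be their
  product \<open>T^2 - M^2\<close>; being bounded below, it would force \<open>T\<close> to have
  norm strictly less than \<open>M\<close>.\<close>

lemma selfadj_norm_in_spectrum:
  assumes T: "selfadj T" and "T \<noteq> 0"
  shows "complex_of_real (norm T) \<in> spectrum T \<or> complex_of_real (- norm T) \<in> spectrum T"
proof (rule ccontr)
  assume contra: "\<not> ?thesis"
  define M where "M = norm T"
  have M: "0 < M"
    using \<open>T \<noteq> 0\<close> by (simp add: M_def)
  define C where "C = (T - scalar_op (of_real M)) o\<^sub>L (T - scalar_op (of_real (- M)))"
  have "cinvertible C"
    using contra unfolding C_def by (intro cinvertible_compose) (simp_all add: in_spectrum_iff M_def)
  then obtain B where B: "B o\<^sub>L C = id_blinfun"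
    by (auto simp: cinvertible_def)
  \<comment> \<open>The added 1 keeps \<open>b\<close> positive. \<open>e\<close> is the gap left in
    \<open>M\<^sup>2\<close> once \<open>x\<close> is recovered from \<open>C x\<close> through
    \<open>B\<close>.\<close>
  define b where "b = (norm B)\<^sup>2 + 1"
  have b: "0 < b"
    by (simp add: b_def add_nonneg_pos)
  define e where "e = 1 / (b * M\<^sup>2)"
  have e: "0 < e"
    using b M by (simp add: e_def)
  have key: "(norm (blinfun_apply T x))\<^sup>2 \<le> (M\<^sup>2 - e) * (norm x)\<^sup>2" for x
  proof -
    let ?y = "blinfun_apply T (blinfun_apply T x)"
    have C_apply: "blinfun_apply C x = ?y - M\<^sup>2 *\<^sub>R x"
      by (simp add: C_def scalar_op_of_real blinfun.bilinear_simps power2_eq_square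
          algebra_simps del: of_real_minus)
    have "(norm ?y)\<^sup>2 \<le> (M * norm (blinfun_apply T x))\<^sup>2"
      unfolding M_def by (intro power_mono norm_blinfun) simp
    moreover have "Re (cinner ?y x) = (norm (blinfun_apply T x))\<^sup>2"
      by (simp add: selfadj_cinner[OF T, of "blinfun_apply T x" x] cinner_self)
    \<comment> \<open>Expand the square of \<open>T^2 x - M^2 x\<close>: its cross term is
      \<open>- 2 * M^2\<close> times the squared norm of \<open>T x\<close>, and the first square is
      at most \<open>M^2\<close> times that squared norm.\<close>
    ultimately have C_le: "(norm (blinfun_apply C x))\<^sup>2 \<le>
        M\<^sup>2 * (M\<^sup>2 * (norm x)\<^sup>2 - (norm (blinfun_apply T x))\<^sup>2)"
      unfolding C_apply norm_diff_square
      by (simp add: cinner_simps power_mult_distrib algebra_simps power2_eq_square)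
    have "x = blinfun_apply B (blinfun_apply C x)"
      using B by (metis blinfun_apply_blinfun_compose blinfun_apply_id_blinfun id_apply)
    then have "norm x \<le> norm B * norm (blinfun_apply C x)"
      by (metis norm_blinfun)
    then have "(norm x)\<^sup>2 \<le> (norm B * norm (blinfun_apply C x))\<^sup>2"
      by (intro power_mono) simp_all
    also have "\<dots> \<le> b * (norm (blinfun_apply C x))\<^sup>2"
      unfolding power_mult_distrib b_def by (intro mult_right_mono) simp_all
    also have "\<dots> \<le> b * (M\<^sup>2 * (M\<^sup>2 * (norm x)\<^sup>2 - (norm (blinfun_apply T x))\<^sup>2))"
      using b C_le by (intro mult_left_mono) simp_all
    finally have "e * (norm x)\<^sup>2 \<le> M\<^sup>2 * (norm x)\<^sup>2 - (norm (blinfun_apply T x))\<^sup>2"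
      using b M by (simp add: e_def divide_le_eq mult_ac)
    then show ?thesis
      by (simp add: algebra_simps)
  qed
  have "norm T \<le> sqrt (max 0 (M\<^sup>2 - e))"
  proof (rule norm_blinfun_bound)
    fix x
    have "(norm (blinfun_apply T x))\<^sup>2 \<le> max 0 (M\<^sup>2 - e) * (norm x)\<^sup>2"
      by (rule order_trans[OF key]) (simp add: mult_right_mono)
    then have "sqrt ((norm (blinfun_apply T x))\<^sup>2) \<le> sqrt (max 0 (M\<^sup>2 - e) * (norm x)\<^sup>2)"
      by (rule real_sqrt_le_mono)
    then show "norm (blinfun_apply T x) \<le> sqrt (max 0 (M\<^sup>2 - e)) * norm x"
      by (simp add: real_sqrt_mult)
  qed simp
  also have "\<dots> < sqrt (M\<^sup>2)"
    using e M by (intro real_sqrt_less_mono) simp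
  finally show False
    using M by (simp add: M_def)
qed

text \<open>\<open>T\<close> certifies that the space is nonzero; on the zero space every operator
  is invertible and all spectra are empty.\<close>

lemma selfadj_spectrum_nonempty:
  fixes A T :: "'a::chilbert_space \<Rightarrow>\<^sub>L 'a"
  assumes A: "selfadj A" and T: "T \<noteq> 0"
  obtains t where "complex_of_real t \<in> spectrum A"
proof (cases "A = 0")
  case True
  have "\<not> cinvertible (0 :: 'a \<Rightarrow>\<^sub>L 'a)"
  proof
    assume "cinvertible (0 :: 'a \<Rightarrow>\<^sub>L 'a)"
    then have "id_blinfun = (0 :: 'a \<Rightarrow>\<^sub>L 'a)"
      by (auto simp: cinvertible_def)
    then have "blinfun_apply T x = 0" for x
      by (metis blinfun_apply_id_blinfun id_apply blinfun.zero_left)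
    then show False
      using T by (metis blinfun_eqI blinfun.zero_left)
  qed
  then show thesis
    using True that[of 0] by (simp add: in_spectrum_iff)
next
  case False
  then show thesis
    using selfadj_norm_in_spectrum[OF A] that by blast
qed

section \<open>Polynomials in an operator\<close>

text \<open>Complex coefficients allow splitting into linear factors, and the Horner recursion suits
  induction on \<open>pCons\<close>.\<close>

definition cop_poly :: "complex poly \<Rightarrow> ('a::chilbert_space \<Rightarrow>\<^sub>L 'a) \<Rightarrow> 'a \<Rightarrow>\<^sub>L 'a" where
  "cop_poly p A = fold_coeffs (\<lambda>a B. scalar_op a + (A o\<^sub>L B)) p 0"

lemma scalar_op_add: "scalar_op (a + b) = scalar_op a + scalar_op b"
  by (rule blinfun_eqI) (simp add: blinfun.add_left scaleC_add_left)

lemma scalar_op_mult: "scalar_op (a * b) = scalar_op a o\<^sub>L scalar_op b"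
  by (rule blinfun_eqI) (simp add: scaleC_scaleC)

lemma cop_poly_0 [simp]: "cop_poly 0 A = 0"
  by (simp add: cop_poly_def)

lemma cop_poly_pCons [simp]: "cop_poly (pCons a p) A = scalar_op a + (A o\<^sub>L cop_poly p A)"
  by (cases "p = 0 \<and> a = 0") (auto simp: cop_poly_def)

lemma cop_poly_add: "cop_poly (p + q) A = cop_poly p A + cop_poly q A"
  by (induct p q rule: poly_induct2)
    (auto intro!: blinfun_eqI simp: blinfun.bilinear_simps scalar_op_add)

lemma cop_poly_smult:
  "A \<in> cblin \<Longrightarrow> cop_poly (smult c p) A = scalar_op c o\<^sub>L cop_poly p A"
  by (induct p)
    (auto intro!: blinfun_eqI simp: blinfun.bilinear_simps scalar_op_mult scaleC_add_right cblin_scaleC)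

lemma cop_poly_mult:
  "A \<in> cblin \<Longrightarrow> cop_poly (p * q) A = cop_poly p A o\<^sub>L cop_poly q A"
  by (induct p)
    (auto intro!: blinfun_eqI simp: blinfun.bilinear_simps cop_poly_add cop_poly_smult)

lemma cinvertible_scalar_op: "c \<noteq> 0 \<Longrightarrow> cinvertible (scalar_op c)"
  unfolding cinvertible_def
  by (rule bexI[of _ "scalar_op (inverse c)"])
    (auto intro!: blinfun_eqI cblin_closed simp: scaleC_scaleC scaleC_one)

text \<open>One inclusion of spectral mapping: by the fundamental theorem of algebra the polynomial
  is a constant times linear factors, each invertible at \<open>A\<close> because its root avoids
  the spectrum.\<close>

lemma cinvertible_cop_poly:
  assumes A: "A \<in> cblin" and "p \<noteq> 0" "\<And>z. poly p z = 0 \<Longrightarrow> z \<notin> spectrum A"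
  shows "cinvertible (cop_poly p A)"
  using assms(2,3)
proof (induct "degree p" arbitrary: p)
  case 0
  then obtain c where "p = [:c:]" "c \<noteq> 0"
    by (metis degree_eq_zeroE pCons_0_0)
  then show ?case
    by (simp add: cinvertible_scalar_op)
next
  case (Suc n)
  have "\<not> constant (poly p)"
    using Suc(2) by (simp add: constant_degree)
  then obtain z where z: "poly p z = 0"
    using fundamental_theorem_of_algebra by blast
  then obtain r where r: "p = [:- z, 1:] * r"
    by (auto simp: poly_eq_0_iff_dvd)
  have "r \<noteq> 0"
    using Suc(3) r by auto
  have "degree p = Suc (degree r)"
    unfolding r using \<open>r \<noteq> 0\<close> by (subst degree_mult_eq) auto
  then have "cinvertible (cop_poly r A)"
    using Suc \<open>r \<noteq> 0\<close> r by (intro Suc(1)) auto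
  moreover have "cop_poly [:- z, 1:] A = A - scalar_op z"
    by (rule blinfun_eqI) (simp add: blinfun.bilinear_simps scaleC_one scaleC_minus_left)
  moreover have "cinvertible (A - scalar_op z)"
    using Suc(4)[OF z] by (simp add: in_spectrum_iff)
  ultimately show ?case
    unfolding r cop_poly_mult[OF A] by (simp add: cinvertible_compose)
qed

section \<open>Real polynomials in an operator and their norms\<close>

lemma op_poly_eq_sum:
  assumes "degree q \<le> n"
  shows "op_poly q A = (\<Sum>i\<le>n. coeff q i *\<^sub>R (((o\<^sub>L) A ^^ i) id_blinfun))"
  unfolding op_poly_def
  using assms by (intro sum.mono_neutral_left) (auto simp: coeff_eq_0)

lemma op_poly_0 [simp]: "op_poly 0 A = 0"
  by (simp add: op_poly_def)

lemma op_poly_pCons [simp]: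
  "op_poly (pCons a q) A = a *\<^sub>R id_blinfun + (A o\<^sub>L op_poly q A)"
proof -
  \<comment> \<open>For \<open>q = 0\<close> this upper index exceeds the degree by one; the extra
    coefficient is zero, so no case distinction is needed.\<close>
  have "op_poly (pCons a q) A =
      (\<Sum>i\<le>Suc (degree q). coeff (pCons a q) i *\<^sub>R (((o\<^sub>L) A ^^ i) id_blinfun))"
    by (rule op_poly_eq_sum) (simp add: degree_pCons_le)
  also have "\<dots> = a *\<^sub>R id_blinfun + (A o\<^sub>L op_poly q A)"
    unfolding op_poly_def
    by (subst sum.atMost_Suc_shift)
      (simp add: bounded_bilinear.sum_right[OF bounded_bilinear_blinfun_compose]
        bounded_bilinear.scaleR_right[OF bounded_bilinear_blinfun_compose])
  finally show ?thesis .
qed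

lemma op_poly_eq_cop_poly: "op_poly q A = cop_poly (map_poly complex_of_real q) A"
  by (induct q) (simp_all add: map_poly_pCons scalar_op_of_real)

lemma op_poly_add: "op_poly (p + q) A = op_poly p A + op_poly q A"
  by (induct p q rule: poly_induct2)
    (auto intro!: blinfun_eqI simp: blinfun.bilinear_simps algebra_simps)

lemma op_poly_smult: "op_poly (smult c p) A = c *\<^sub>R op_poly p A"
  by (induct p) (auto intro!: blinfun_eqI simp: blinfun.bilinear_simps algebra_simps)

lemma op_poly_diff: "op_poly (p - q) A = op_poly p A - op_poly q A"
  using op_poly_add[of "p - q" q A] by (simp add: algebra_simps)

lemma op_poly_mult: "op_poly (p * q) A = op_poly p A o\<^sub>L op_poly q A"
  by (induct p)
    (auto intro!: blinfun_eqI simp: blinfun.bilinear_simps op_poly_add op_poly_smult)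

lemma op_poly_commute: "A o\<^sub>L op_poly q A = op_poly q A o\<^sub>L A"
proof (induct q)
  case (pCons a q)
  then have "blinfun_apply A (blinfun_apply (op_poly q A) x) = blinfun_apply (op_poly q A) (blinfun_apply A x)" for x
    by (metis blinfun_apply_blinfun_compose)
  then show ?case
    by (auto intro!: blinfun_eqI simp: blinfun.bilinear_simps)
qed simp

lemma selfadj_op_poly:
  assumes A: "selfadj A"
  shows "selfadj (op_poly q A)"
proof (induct q)
  case (pCons a q)
  have comm: "blinfun_apply A (blinfun_apply (op_poly q A) x) = blinfun_apply (op_poly q A) (blinfun_apply A x)" for x
    using op_poly_commute[of A q] by (metis blinfun_apply_blinfun_compose)
  have "a *\<^sub>R id_blinfun + (A o\<^sub>L op_poly q A) \<in> cblin"
    using A pCons by (intro cblin_closed selfadj_cblin)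
  then show ?case
    using selfadj_cinner[OF A] selfadj_cinner[OF pCons(2)]
    by (auto simp: selfadj_def blinfun.bilinear_simps cinner_simps comm)
qed (simp add: selfadj_def cblin_closed)

text \<open>The norm of \<open>q(A)\<close>, up to sign, lies in the spectrum of \<open>q(A)\<close>; factoring \<open>q - l\<close> into linear
  factors shows that every \<open>l\<close> in that spectrum is a value of \<open>q\<close> on the spectrum of \<open>A\<close>.\<close>

lemma norm_op_poly_le:
  assumes A: "selfadj A" and e: "0 \<le> e"
    and le: "\<And>t. complex_of_real t \<in> spectrum A \<Longrightarrow> \<bar>poly q t\<bar> \<le> e"
  shows "norm (op_poly q A) \<le> e"
proof (cases "op_poly q A = 0")
  case False
  obtain l where l: "\<bar>l\<bar> = norm (op_poly q A)" "complex_of_real l \<in> spectrum (op_poly q A)"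
    using selfadj_norm_in_spectrum[OF selfadj_op_poly[OF A] False]
    by (metis abs_minus_cancel abs_norm_cancel)
  define r where "r = q - [:l:]"
  define p where "p = map_poly complex_of_real r"
  have "\<exists>t. complex_of_real t \<in> spectrum A \<and> poly r t = 0"
  proof (cases "p = 0")
    \<comment> \<open>Here \<open>q\<close> is the constant \<open>l\<close>, so any spectral point
      serves; one exists since \<open>op_poly q A\<close> is a nonzero operator.\<close>
    case True
    then have "r = 0"
      by (simp add: p_def map_poly_eq_0_iff)
    then show ?thesis
      using selfadj_spectrum_nonempty[OF A False] by auto
  next
    case p: False
    have "op_poly q A - scalar_op (of_real l) = cop_poly p A"
      unfolding p_def r_def op_poly_eq_cop_poly[symmetric]
      by (simp add: op_poly_diff scalar_op_of_real)
    then have "\<not> cinvertible (cop_poly p A)"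
      using l(2) by (simp add: in_spectrum_iff)
    then obtain z where z: "poly p z = 0" "z \<in> spectrum A"
      using cinvertible_cop_poly[OF selfadj_cblin[OF A] p] by blast
    then have "z = of_real (Re z)"
      using selfadj_spectrum_real[OF A z(2)] by (simp add: complex_eq_iff)
    moreover have "poly p (of_real t) = of_real (poly r t)" for t
      unfolding p_def by (induct r) (simp_all add: map_poly_pCons)
    ultimately show ?thesis
      using z by (metis of_real_eq_0_iff)
  qed
  then obtain t where "complex_of_real t \<in> spectrum A" "poly q t = l"
    by (auto simp: r_def)
  then show ?thesis
    using le[of t] l(1) by simp
qed (use e in simp)

section \<open>Continuous functional calculus\<close>

lemma poly_add_fun: "poly (p + q) = (\<lambda>t. poly p t + poly q t)"
  and poly_mult_fun: "poly (p * q) = (\<lambda>t. poly p t * poly q t)"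
  by (simp_all add: fun_eq_iff)

lemma poly_diff_fun: "poly (p - q) = (\<lambda>t. poly p t - poly (q :: 'a::comm_ring poly) t)"
  by (simp add: fun_eq_iff)

lemma polynomial_uniform_approximation:
  fixes f :: "real \<Rightarrow> real"
  assumes f: "continuous_on {a..b} f"
  obtains q :: "nat \<Rightarrow> real poly"
  where "uniform_limit {a..b} (\<lambda>n. poly (q n)) f sequentially"
proof -
  have "\<exists>q :: real poly. \<forall>t\<in>{a..b}. \<bar>f t - poly q t\<bar> < inverse (real (Suc n))" for n
  proof -
    obtain g where g: "real_polynomial_function g"
        "\<And>t. t \<in> {a..b} \<Longrightarrow> \<bar>f t - g t\<bar> < inverse (real (Suc n))"
      using Stone_Weierstrass_real_polynomial_function[OF _ f, of "inverse (real (Suc n))"] by auto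
    then obtain c m where "g = (\<lambda>t. \<Sum>i\<le>m. c i * t ^ i)"
      by (auto simp: real_polynomial_function_iff_sum)
    then have "g = poly (\<Sum>i\<le>m. monom (c i) i)"
      by (simp add: poly_sum poly_monom fun_eq_iff)
    then show ?thesis
      using g(2) by blast
  qed
  then obtain q :: "nat \<Rightarrow> real poly" where
    q: "\<And>n t. t \<in> {a..b} \<Longrightarrow> \<bar>f t - poly (q n) t\<bar> < inverse (real (Suc n))"
    by metis
  have "uniform_limit {a..b} (\<lambda>n. poly (q n)) f sequentially"
  proof (rule uniform_limitI)
    fix e :: real
    assume "0 < e"
    then have "\<forall>\<^sub>F n in sequentially. inverse (real (Suc n)) < e"
      using LIMSEQ_inverse_real_of_nat by (rule order_tendstoD(2)[rotated])
    then show "\<forall>\<^sub>F n in sequentially. \<forall>t\<in>{a..b}. dist (poly (q n) t) (f t) < e"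
    proof eventually_elim
      case (elim n)
      then show ?case
        using less_trans[OF q[of _ n]] by (auto simp: dist_real_def abs_minus_commute)
    qed
  qed
  then show thesis by (rule that)
qed

lemma op_poly_tendsto_0:
  assumes A: "selfadj A"
    and lim: "uniform_limit {t. complex_of_real t \<in> spectrum A} (\<lambda>n. poly (q n)) (\<lambda>t. 0) sequentially"
  shows "(\<lambda>n. op_poly (q n) A) \<longlonglongrightarrow> 0"
proof (rule tendstoI)
  fix e :: real
  assume "0 < e"
  then have "\<forall>\<^sub>F n in sequentially. \<forall>t\<in>{t. complex_of_real t \<in> spectrum A}. dist (poly (q n) t) 0 < e / 2"
    by (intro uniform_limitD[OF lim]) simp
  then show "\<forall>\<^sub>F n in sequentially. dist (op_poly (q n) A) 0 < e"
  proof eventually_elim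
    case (elim n)
    then have "norm (op_poly (q n) A) \<le> e / 2"
      using \<open>0 < e\<close> by (intro norm_op_poly_le[OF A]) (auto intro: less_imp_le)
    then show ?case
      using \<open>0 < e\<close> by simp
  qed
qed

text \<open>Uniform closeness on the spectrum becomes norm closeness by
  \<open>norm_op_poly_le\<close>, and the operator space is complete.\<close>

lemma op_poly_convergent:
  assumes A: "selfadj A"
    and lim: "uniform_limit {t. complex_of_real t \<in> spectrum A} (\<lambda>n. poly (q n)) f sequentially"
  shows "convergent (\<lambda>n. op_poly (q n) A)"
proof (rule Cauchy_convergent, rule metric_CauchyI)
  fix e :: real
  assume "0 < e"
  then have "\<forall>\<^sub>F n in sequentially. \<forall>t\<in>{t. complex_of_real t \<in> spectrum A}. dist (poly (q n) t) (f t) < e / 4"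
    by (intro uniform_limitD[OF lim]) simp
  then obtain M where M: "\<And>n t. n \<ge> M \<Longrightarrow> complex_of_real t \<in> spectrum A \<Longrightarrow> dist (poly (q n) t) (f t) < e / 4"
    by (auto simp: eventually_sequentially)
  have "dist (op_poly (q m) A) (op_poly (q n) A) < e" if mn: "m \<ge> M" "n \<ge> M" for m n
  proof -
    have "norm (op_poly (q m - q n) A) \<le> e / 2"
    proof (rule norm_op_poly_le[OF A])
      fix t
      assume "complex_of_real t \<in> spectrum A"
      then show "\<bar>poly (q m - q n) t\<bar> \<le> e / 2"
        using M[OF mn(1), of t] M[OF mn(2), of t] unfolding dist_real_def poly_diff by linarith
    qed (use \<open>0 < e\<close> in simp)
    then show ?thesis
      using \<open>0 < e\<close> by (simp add: op_poly_diff dist_norm)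
  qed
  then show "\<exists>M. \<forall>m\<ge>M. \<forall>n\<ge>M. dist (op_poly (q m) A) (op_poly (q n) A) < e"
    by blast
qed

text \<open>Working on an interval around the spectrum gives Weierstrass approximation and
  boundedness of continuous functions without any topology of the spectrum itself.\<close>

locale selfadj_Icc =
  fixes A :: "'a::chilbert_space \<Rightarrow>\<^sub>L 'a" and a b :: real
  assumes selfadj: "selfadj A"
    and spectrum_subset: "spectrum A \<subseteq> complex_of_real ` {a..b}"
begin

lemma real_spectrum_subset: "{t. complex_of_real t \<in> spectrum A} \<subseteq> {a..b}"
  using spectrum_subset by fastforce

text \<open>This discharges the definite description. One approximating sequence exists, so at most
  one operator fits; two such sequences differ by polynomials tending uniformly to 0 on the
  spectrum, so its limit fits all of them.\<close>

lemma cfc_LIMSEQ: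
  assumes f: "continuous_on {a..b} f"
    and lim: "uniform_limit {t. complex_of_real t \<in> spectrum A} (\<lambda>n. poly (q n)) f sequentially"
  shows "(\<lambda>n. op_poly (q n) A) \<longlonglongrightarrow> cfc f A"
proof -
  let ?S = "{t. complex_of_real t \<in> spectrum A}"
  obtain q0 :: "nat \<Rightarrow> real poly" where "uniform_limit {a..b} (\<lambda>n. poly (q0 n)) f sequentially"
    using polynomial_uniform_approximation[OF f] .
  then have q0: "uniform_limit ?S (\<lambda>n. poly (q0 n)) f sequentially"
    using real_spectrum_subset by (rule uniform_limit_on_subset)
  obtain B where B: "(\<lambda>n. op_poly (q0 n) A) \<longlonglongrightarrow> B"
    using op_poly_convergent[OF selfadj q0] by (auto simp: convergent_def)
  have all: "(\<lambda>n. op_poly (r n) A) \<longlonglongrightarrow> B"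
    if r: "uniform_limit ?S (\<lambda>n. poly (r n)) f sequentially" for r
  proof -
    have "uniform_limit ?S (\<lambda>n. poly (r n - q0 n)) (\<lambda>t. 0) sequentially"
      using uniform_limit_minus[OF r q0] by (simp add: poly_diff_fun)
    then have "(\<lambda>n. op_poly (r n - q0 n) A) \<longlonglongrightarrow> 0"
      by (rule op_poly_tendsto_0[OF selfadj])
    then have "(\<lambda>n. op_poly (r n - q0 n) A + op_poly (q0 n) A) \<longlonglongrightarrow> 0 + B"
      using B by (rule tendsto_add)
    then show ?thesis
      by (simp add: op_poly_diff)
  qed
  have "cfc f A = B"
    unfolding cfc_def
  proof (rule the_equality)
    fix C
    assume "\<forall>q. uniform_limit ?S (\<lambda>n. poly (q n)) f sequentially \<longrightarrow> (\<lambda>n. op_poly (q n) A) \<longlonglongrightarrow> C"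
    then show "C = B"
      using q0 B LIMSEQ_unique by blast
  qed (use all in blast)
  then show ?thesis
    using all[OF lim] by simp
qed

lemma cfc_LIMSEQ_Icc:
  assumes "continuous_on {a..b} f"
    and "uniform_limit {a..b} (\<lambda>n. poly (q n)) f sequentially"
  shows "(\<lambda>n. op_poly (q n) A) \<longlonglongrightarrow> cfc f A"
  using assms uniform_limit_on_subset[OF _ real_spectrum_subset] by (intro cfc_LIMSEQ) blast+

lemma cfc_approx:
  assumes f: "continuous_on {a..b} f"
  obtains q where "uniform_limit {a..b} (\<lambda>n. poly (q n)) f sequentially"
    "(\<lambda>n. op_poly (q n) A) \<longlonglongrightarrow> cfc f A"
  using polynomial_uniform_approximation[OF f] cfc_LIMSEQ_Icc[OF f] by metis

lemma cfc_poly: "cfc (poly q) A = op_poly q A"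
proof -
  have "(\<lambda>n. op_poly q A) \<longlonglongrightarrow> cfc (poly q) A"
    by (rule cfc_LIMSEQ_Icc) (auto intro!: continuous_intros uniform_limit_const)
  then show ?thesis
    by (simp add: LIMSEQ_const_iff)
qed

lemma cfc_cong:
  assumes "\<And>t. t \<in> {a..b} \<Longrightarrow> f t = g t"
  shows "cfc f A = cfc g A"
proof -
  have "uniform_limit {t. complex_of_real t \<in> spectrum A} (\<lambda>n. poly (q n)) f sequentially \<longleftrightarrow>
      uniform_limit {t. complex_of_real t \<in> spectrum A} (\<lambda>n. poly (q n)) g sequentially" for q
    using assms real_spectrum_subset by (intro uniform_limit_cong') auto
  then show ?thesis
    by (simp add: cfc_def)
qed

lemma cfc_add:
  assumes f: "continuous_on {a..b} f" and g: "continuous_on {a..b} g"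
  shows "cfc (\<lambda>t. f t + g t) A = cfc f A + cfc g A"
proof -
  obtain p where p: "uniform_limit {a..b} (\<lambda>n. poly (p n)) f sequentially"
    "(\<lambda>n. op_poly (p n) A) \<longlonglongrightarrow> cfc f A"
    using cfc_approx[OF f] .
  obtain q where q: "uniform_limit {a..b} (\<lambda>n. poly (q n)) g sequentially"
    "(\<lambda>n. op_poly (q n) A) \<longlonglongrightarrow> cfc g A"
    using cfc_approx[OF g] .
  have "uniform_limit {a..b} (\<lambda>n. poly (p n + q n)) (\<lambda>t. f t + g t) sequentially"
    using uniform_limit_add[OF p(1) q(1)] by (simp add: poly_add_fun)
  then have "(\<lambda>n. op_poly (p n + q n) A) \<longlonglongrightarrow> cfc (\<lambda>t. f t + g t) A"
    by (intro cfc_LIMSEQ_Icc continuous_on_add f g)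
  moreover have "(\<lambda>n. op_poly (p n + q n) A) \<longlonglongrightarrow> cfc f A + cfc g A"
    unfolding op_poly_add by (intro tendsto_add p q)
  ultimately show ?thesis
    by (rule LIMSEQ_unique)
qed

lemma cfc_mult:
  assumes f: "continuous_on {a..b} f" and g: "continuous_on {a..b} g"
  shows "cfc (\<lambda>t. f t * g t) A = cfc f A o\<^sub>L cfc g A"
proof -
  obtain p where p: "uniform_limit {a..b} (\<lambda>n. poly (p n)) f sequentially"
    "(\<lambda>n. op_poly (p n) A) \<longlonglongrightarrow> cfc f A"
    using cfc_approx[OF f] .
  obtain q where q: "uniform_limit {a..b} (\<lambda>n. poly (q n)) g sequentially"
    "(\<lambda>n. op_poly (q n) A) \<longlonglongrightarrow> cfc g A"
    using cfc_approx[OF g] .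
  have "bounded (f ` {a..b})" "bounded (g ` {a..b})"
    using f g by (auto intro!: compact_imp_bounded compact_continuous_image)
  then have "uniform_limit {a..b} (\<lambda>n. poly (p n * q n)) (\<lambda>t. f t * g t) sequentially"
    using uniform_lim_mult[OF p(1) q(1)] by (simp add: poly_mult_fun)
  then have "(\<lambda>n. op_poly (p n * q n) A) \<longlonglongrightarrow> cfc (\<lambda>t. f t * g t) A"
    by (intro cfc_LIMSEQ_Icc continuous_on_mult f g)
  moreover have "(\<lambda>n. op_poly (p n * q n) A) \<longlonglongrightarrow> (cfc f A o\<^sub>L cfc g A)"
    unfolding op_poly_mult
    by (intro bounded_bilinear.tendsto[OF bounded_bilinear_blinfun_compose] p q)
  ultimately show ?thesis
    by (rule LIMSEQ_unique)
qed

lemma cfc_const: "cfc (\<lambda>t. c) A = c *\<^sub>R id_blinfun"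
proof -
  have "poly [:c:] = (\<lambda>t. c)"
    by (simp add: fun_eq_iff)
  then show ?thesis
    using cfc_poly[of "[:c:]"] by simp
qed

lemma cfc_ident: "cfc (\<lambda>t. t) A = A"
proof -
  have "poly [:0, 1:] = (\<lambda>t :: real. t)"
    by (simp add: fun_eq_iff)
  moreover have "op_poly [:0, 1:] A = A"
    by (rule blinfun_eqI) (simp add: blinfun.bilinear_simps)
  ultimately show ?thesis
    using cfc_poly[of "[:0, 1:]"] by simp
qed

lemma cfc_cmult:
  "continuous_on {a..b} f \<Longrightarrow> cfc (\<lambda>t. c * f t) A = c *\<^sub>R cfc f A"
  by (subst cfc_mult) (auto intro!: blinfun_eqI simp: cfc_const blinfun.bilinear_simps)

lemma norm_cfc_le:
  assumes f: "continuous_on {a..b} f" and e: "0 \<le> e"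
    and le: "\<And>t. t \<in> {a..b} \<Longrightarrow> \<bar>f t\<bar> \<le> e"
  shows "norm (cfc f A) \<le> e"
proof (rule field_le_epsilon)
  fix d :: real
  assume d: "0 < d"
  obtain q where q: "uniform_limit {a..b} (\<lambda>n. poly (q n)) f sequentially"
    "(\<lambda>n. op_poly (q n) A) \<longlonglongrightarrow> cfc f A"
    using cfc_approx[OF f] .
  have "\<forall>\<^sub>F n in sequentially. norm (op_poly (q n) A) \<le> e + d"
    using uniform_limitD[OF q(1) d]
  proof eventually_elim
    case (elim n)
    show ?case
    proof (rule norm_op_poly_le[OF selfadj])
      fix t
      assume "complex_of_real t \<in> spectrum A"
      then have "t \<in> {a..b}"
        using real_spectrum_subset by blast
      then show "\<bar>poly (q n) t\<bar> \<le> e + d"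
        using elim le[of t] by (fastforce simp: dist_real_def)
    qed (use e d in simp)
  qed
  then show "norm (cfc f A) \<le> e + d"
    by (intro tendsto_upperbound[OF tendsto_norm[OF q(2)]]) simp_all
qed

lemma selfadj_cfc:
  assumes f: "continuous_on {a..b} f"
  shows "selfadj (cfc f A)"
proof -
  obtain q where q: "(\<lambda>n. op_poly (q n) A) \<longlonglongrightarrow> cfc f A"
    using cfc_approx[OF f] .
  have app: "(\<lambda>n. blinfun_apply (op_poly (q n) A) x) \<longlonglongrightarrow> blinfun_apply (cfc f A) x" for x
    by (intro blinfun.tendsto q tendsto_const)
  have sa: "selfadj (op_poly (q n) A)" for n
    by (rule selfadj_op_poly[OF selfadj])
  have "cinner (blinfun_apply (cfc f A) x) y = cinner x (blinfun_apply (cfc f A) y)" for x y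
  proof (rule LIMSEQ_unique)
    show "(\<lambda>n. cinner (blinfun_apply (op_poly (q n) A) x) y) \<longlonglongrightarrow> cinner (blinfun_apply (cfc f A) x) y"
      by (intro bounded_bilinear.tendsto[OF bounded_bilinear_cinner] app tendsto_const)
    show "(\<lambda>n. cinner (blinfun_apply (op_poly (q n) A) x) y) \<longlonglongrightarrow> cinner x (blinfun_apply (cfc f A) y)"
      unfolding selfadj_cinner[OF sa]
      by (intro bounded_bilinear.tendsto[OF bounded_bilinear_cinner] app tendsto_const)
  qed
  moreover have "blinfun_apply (cfc f A) (c *\<^sub>C x) = c *\<^sub>C blinfun_apply (cfc f A) x" for c x
  proof (rule LIMSEQ_unique[OF app])
    show "(\<lambda>n. blinfun_apply (op_poly (q n) A) (c *\<^sub>C x)) \<longlonglongrightarrow> c *\<^sub>C blinfun_apply (cfc f A) x"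
      using blinfun.tendsto[OF tendsto_const[of "scalar_op c"] app[of x]]
      by (simp add: cblin_scaleC[OF selfadj_cblin[OF sa]])
  qed
  ultimately show ?thesis
    by (simp add: selfadj_def cblin_def)
qed

text \<open>For \<open>s\<close> outside \<open>{c..d}\<close> the operator \<open>cfc (\<lambda>t. 1 / (f t - s)) A\<close> inverts \<open>cfc f A - s\<close>.\<close>

lemma selfadj_Icc_cfc:
  assumes f: "continuous_on {a..b} f" and im: "f ` {a..b} \<subseteq> {c..d}"
  shows "selfadj_Icc (cfc f A) c d"
proof
  show "selfadj (cfc f A)"
    by (rule selfadj_cfc[OF f])
  show "spectrum (cfc f A) \<subseteq> complex_of_real ` {c..d}"
  proof
    fix l
    assume l: "l \<in> spectrum (cfc f A)"
    define s where "s = Re l"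
    have ls: "l = of_real s"
      using selfadj_spectrum_real[OF selfadj_cfc[OF f] l] by (simp add: s_def complex_eq_iff)
    have "s \<in> {c..d}"
    proof (rule ccontr)
      assume s: "s \<notin> {c..d}"
      \<comment> \<open>Subtraction is written as adding a constant so that \<open>cfc_add\<close>
        and \<open>cfc_const\<close> apply.\<close>
      let ?g = "\<lambda>t. f t + (- s)"
      have nz: "?g t \<noteq> 0" if "t \<in> {a..b}" for t
        using im s that by (auto simp: image_subset_iff)
      have g: "continuous_on {a..b} ?g"
        by (intro continuous_intros f)
      have h: "continuous_on {a..b} (\<lambda>t. inverse (?g t))"
        using nz by (intro continuous_on_inverse g) blast
      have "cfc ?g A = cfc f A - scalar_op l"
        by (subst cfc_add[OF f]) (auto simp: cfc_const ls scalar_op_of_real)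
      moreover have "cfc (\<lambda>t. inverse (?g t)) A o\<^sub>L cfc ?g A = id_blinfun"
        "cfc ?g A o\<^sub>L cfc (\<lambda>t. inverse (?g t)) A = id_blinfun"
        unfolding cfc_mult[OF h g, symmetric] cfc_mult[OF g h, symmetric]
        using cfc_cong[of "\<lambda>t. inverse (?g t) * ?g t" "\<lambda>t. 1"]
          cfc_cong[of "\<lambda>t. ?g t * inverse (?g t)" "\<lambda>t. 1"] nz
        by (auto simp: cfc_const)
      ultimately have "cinvertible (cfc f A - scalar_op l)"
        unfolding cinvertible_def using selfadj_cblin[OF selfadj_cfc[OF h]] by metis
      then show False
        using l by (simp add: in_spectrum_iff)
    qed
    then show "l \<in> complex_of_real ` {c..d}"
      using ls by simp
  qed
qed

lemma op_poly_cfc: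
  assumes f: "continuous_on {a..b} f"
  shows "op_poly r (cfc f A) = cfc (\<lambda>t. poly r (f t)) A"
proof (induct r)
  case 0
  then show ?case
    using cfc_const[of 0] by simp
next
  case (pCons c r)
  have "continuous_on {a..b} (\<lambda>t. poly r (f t))"
    by (intro continuous_intros f)
  then show ?case
    using pCons f by (simp add: cfc_add cfc_mult cfc_const continuous_on_mult)
qed

text \<open>\<open>pnorm\<close> nests a power over a square root, so calculi must compose. For
  polynomial \<open>g\<close> this is \<open>op_poly_cfc\<close>; in general \<open>g\<close> is
  approximated uniformly on an interval containing the values of \<open>f\<close>, and
  \<open>norm_cfc_le\<close> carries the error over.\<close>

lemma cfc_cfc:
  assumes f: "continuous_on {a..b} f" and im: "f ` {a..b} \<subseteq> {c..d}"
    and g: "continuous_on {c..d} g"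
  shows "cfc g (cfc f A) = cfc (\<lambda>t. g (f t)) A"
proof -
  interpret K: selfadj_Icc "cfc f A" c d
    by (rule selfadj_Icc_cfc[OF f im])
  have gf: "continuous_on {a..b} (\<lambda>t. g (f t))"
    by (rule continuous_on_compose2[OF g f im])
  obtain r where r: "uniform_limit {c..d} (\<lambda>n. poly (r n)) g sequentially"
    "(\<lambda>n. op_poly (r n) (cfc f A)) \<longlonglongrightarrow> cfc g (cfc f A)"
    using K.cfc_approx[OF g] .
  have "(\<lambda>n. op_poly (r n) (cfc f A)) \<longlonglongrightarrow> cfc (\<lambda>t. g (f t)) A"
  proof (rule tendstoI)
    fix e :: real
    assume e: "0 < e"
    have "\<forall>\<^sub>F n in sequentially. \<forall>s\<in>{c..d}. dist (poly (r n) s) (g s) < e / 2"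
      using e by (intro uniform_limitD[OF r(1)]) simp
    then show "\<forall>\<^sub>F n in sequentially. dist (op_poly (r n) (cfc f A)) (cfc (\<lambda>t. g (f t)) A) < e"
    proof eventually_elim
      case (elim n)
      have c1: "continuous_on {a..b} (\<lambda>t. poly (r n) (f t))"
        by (intro continuous_intros f)
      have c2: "continuous_on {a..b} (\<lambda>t. (- 1) * g (f t))"
        by (intro continuous_intros gf)
      have "norm (cfc (\<lambda>t. poly (r n) (f t) + (- 1) * g (f t)) A) \<le> e / 2"
      proof (rule norm_cfc_le)
        show "\<bar>poly (r n) (f t) + (- 1) * g (f t)\<bar> \<le> e / 2" if "t \<in> {a..b}" for t
          using bspec[OF elim, of "f t"] that im by (auto simp: dist_real_def image_subset_iff)
        show "continuous_on {a..b} (\<lambda>t. poly (r n) (f t) + (- 1) * g (f t))"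
          by (rule continuous_on_add[OF c1 c2])
      qed (use e in simp)
      also have "cfc (\<lambda>t. poly (r n) (f t) + (- 1) * g (f t)) A =
          op_poly (r n) (cfc f A) - cfc (\<lambda>t. g (f t)) A"
        unfolding cfc_add[OF c1 c2] cfc_cmult[OF gf] op_poly_cfc[OF f] by simp
      finally show ?case
        using e by (simp add: dist_norm)
    qed
  qed
  then show ?thesis
    using r(2) LIMSEQ_unique by blast
qed

end

section \<open>Commutants\<close>

text \<open>The bicommutant condition makes a von Neumann algebra a commutant, so its closure
  properties are proved for commutants.\<close>

lemma commutant_add: "A \<in> commutant S \<Longrightarrow> B \<in> commutant S \<Longrightarrow> A + B \<in> commutant S"
  by (auto intro!: cblin_closed simp: commutant_def
      bounded_bilinear.add_left[OF bounded_bilinear_blinfun_compose]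
      bounded_bilinear.add_right[OF bounded_bilinear_blinfun_compose])

lemma commutant_scaleR: "A \<in> commutant S \<Longrightarrow> r *\<^sub>R A \<in> commutant S"
  by (auto intro!: cblin_closed simp: commutant_def
      bounded_bilinear.scaleR_left[OF bounded_bilinear_blinfun_compose]
      bounded_bilinear.scaleR_right[OF bounded_bilinear_blinfun_compose])

lemma commutant_diff: "A \<in> commutant S \<Longrightarrow> B \<in> commutant S \<Longrightarrow> A - B \<in> commutant S"
  using commutant_add[of A S "- 1 *\<^sub>R B"] commutant_scaleR[of B S "- 1"] by simp

lemma commutant_compose:
  assumes "A \<in> commutant S" "B \<in> commutant S"
  shows "A o\<^sub>L B \<in> commutant S"
proof -
  have "A (C x) = C (A x)" "B (C x) = C (B x)" if "C \<in> S" for C x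
    using assms that unfolding commutant_def by (metis (mono_tags, lifting) blinfun_apply_blinfun_compose mem_Collect_eq)+
  then show ?thesis
    using assms by (auto intro!: blinfun_eqI cblin_closed simp: commutant_def)
qed

lemma commutant_id: "id_blinfun \<in> commutant S"
  by (auto intro!: blinfun_eqI cblin_closed simp: commutant_def)

lemma commutant_op_poly:
  assumes "A \<in> commutant S"
  shows "op_poly q A \<in> commutant S"
proof (induct q)
  case 0
  then show ?case
    using commutant_scaleR[OF commutant_id, of 0 S] by simp
next
  case (pCons a q)
  then show ?case
    using assms by (simp add: commutant_add commutant_scaleR commutant_id commutant_compose)
qed

text \<open>Commuting with a fixed operator survives norm limits of polynomials in
  \<open>A\<close>.\<close>

lemma (in selfadj_Icc) commutant_cfc:
  assumes f: "continuous_on {a..b} f" and A: "A \<in> commutant S"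
  shows "cfc f A \<in> commutant S"
proof -
  obtain q where q: "(\<lambda>n. op_poly (q n) A) \<longlonglongrightarrow> cfc f A"
    using cfc_approx[OF f] .
  have "cfc f A o\<^sub>L C = C o\<^sub>L cfc f A" if "C \<in> S" for C
  proof (rule LIMSEQ_unique)
    show "(\<lambda>n. op_poly (q n) A o\<^sub>L C) \<longlonglongrightarrow> (cfc f A o\<^sub>L C)"
      by (intro bounded_bilinear.tendsto[OF bounded_bilinear_blinfun_compose] q tendsto_const)
    have "op_poly (q n) A o\<^sub>L C = C o\<^sub>L op_poly (q n) A" for n
      using commutant_op_poly[OF A, of "q n"] that by (simp add: commutant_def)
    then show "(\<lambda>n. op_poly (q n) A o\<^sub>L C) \<longlonglongrightarrow> (C o\<^sub>L cfc f A)"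
      using bounded_bilinear.tendsto[OF bounded_bilinear_blinfun_compose tendsto_const[of C] q] by simp
  qed
  then show ?thesis
    using selfadj_cblin[OF selfadj_cfc[OF f]] by (simp add: commutant_def)
qed

section \<open>The trace identity\<close>

text \<open>By compactness, for every \<open>e > 0\<close> there is \<open>K\<close> with \<open>h \<le> e + K g\<close>.\<close>

lemma positive_functional_zero:
  fixes L :: "(real \<Rightarrow> real) \<Rightarrow> real"
  assumes add: "\<And>f g. continuous_on {a..b} f \<Longrightarrow> continuous_on {a..b} g \<Longrightarrow>
      L (\<lambda>t. f t + g t) = L f + L g"
    and cmult: "\<And>c f. continuous_on {a..b} f \<Longrightarrow> L (\<lambda>t. c * f t) = c * L f"
    and pos: "\<And>f. continuous_on {a..b} f \<Longrightarrow> (\<And>t. t \<in> {a..b} \<Longrightarrow> 0 \<le> f t) \<Longrightarrow> 0 \<le> L f"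
    and g: "continuous_on {a..b} g" "\<And>t. t \<in> {a..b} \<Longrightarrow> 0 \<le> g t"
    and h: "continuous_on {a..b} h" "\<And>t. t \<in> {a..b} \<Longrightarrow> 0 \<le> h t"
    and zero: "\<And>t. t \<in> {a..b} \<Longrightarrow> g t = 0 \<Longrightarrow> h t = 0"
    and Lg: "L g = 0"
  shows "L h = 0"
proof -
  have bound: "\<exists>K\<ge>0. \<forall>t\<in>{a..b}. h t \<le> e + K * g t" if e: "0 < e" for e
  proof -
    \<comment> \<open>Off \<open>C\<close> the summand \<open>e\<close> alone dominates
      \<open>h\<close>. On the compact set \<open>C\<close> the function \<open>g\<close> has no
      zero, so the maximum of \<open>h\<close> over the minimum of \<open>g\<close> serves as
      \<open>K\<close>.\<close>
    define C where "C = {t\<in>{a..b}. e \<le> h t}"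
    have "closed C"
      unfolding C_def
      using continuous_closed_preimage[OF h(1) closed_atLeastAtMost closed_atLeast[of e]]
      by (simp add: vimage_def Int_def)
    then have "compact C"
      by (rule compact_Int_closed[OF compact_Icc[of a b], of C, THEN back_subst[of compact]])
        (auto simp: C_def)
    have sub: "C \<subseteq> {a..b}"
      by (auto simp: C_def)
    show ?thesis
    proof (cases "C = {}")
      case True
      then show ?thesis
        by (intro exI[of _ 0]) (fastforce simp: C_def)
    next
      case False
      obtain s where s: "s \<in> C" "\<And>t. t \<in> C \<Longrightarrow> g s \<le> g t"
        using continuous_attains_inf[OF \<open>compact C\<close> False continuous_on_subset[OF g(1) sub]] by blast
      obtain m where m: "m \<in> C" "\<And>t. t \<in> C \<Longrightarrow> h t \<le> h m"
        using continuous_attains_sup[OF \<open>compact C\<close> False continuous_on_subset[OF h(1) sub]] by blast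
      have gs: "0 < g s"
        using s(1) g(2)[of s] zero[of s] e by (force simp: C_def)
      have hm: "0 \<le> h m"
        using m(1) sub h(2) by blast
      have "h t \<le> e + h m / g s * g t" if t: "t \<in> {a..b}" for t
      proof (cases "t \<in> C")
        case True
        have "h t \<le> h m / g s * g s"
          using m(2)[OF True] gs by simp
        also have "\<dots> \<le> h m / g s * g t"
          using s(2)[OF True] gs hm by (intro mult_left_mono) auto
        finally show ?thesis
          using e by simp
      next
        case False
        then have "h t \<le> e"
          using t by (simp add: C_def)
        moreover have "0 \<le> h m / g s * g t"
          using hm gs g(2)[OF t] by simp
        ultimately show ?thesis by linarith
      qed
      then show ?thesis
        using gs hm by (intro exI[of _ "h m / g s"]) simp
    qed
  qed
  have L1: "0 \<le> L (\<lambda>t. 1)"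
    by (rule pos) simp_all
  have "L h \<le> 0 + d" if d: "0 < d" for d
  proof -
    \<comment> \<open>Chosen so that \<open>e * L (\<lambda>t. 1) \<le> d\<close>; the added 1
      covers the case that \<open>L\<close> vanishes on constants.\<close>
    define e where "e = d / (L (\<lambda>t. 1) + 1)"
    have e: "0 < e"
      using d L1 by (simp add: e_def)
    obtain K where K: "\<And>t. t \<in> {a..b} \<Longrightarrow> h t \<le> e + K * g t"
      using bound[OF e] by blast
    have "0 \<le> L (\<lambda>t. (e * 1 + K * g t) + (- 1) * h t)"
      using K by (intro pos continuous_intros g h) simp
    also have "\<dots> = L (\<lambda>t. e * 1 + K * g t) + L (\<lambda>t. (- 1) * h t)"
      by (intro add continuous_intros g h)
    also have "L (\<lambda>t. e * 1 + K * g t) = L (\<lambda>t. e * 1) + L (\<lambda>t. K * g t)"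
      by (intro add continuous_intros g h)
    also have "L (\<lambda>t. e * 1) = e * L (\<lambda>t. 1)"
      by (intro cmult continuous_intros)
    also have "L (\<lambda>t. K * g t) = K * L g"
      by (intro cmult g)
    also have "L (\<lambda>t. (- 1) * h t) = (- 1) * L h"
      by (intro cmult h)
    finally have "L h \<le> e * L (\<lambda>t. 1)"
      using Lg by simp
    also have "\<dots> \<le> d"
      using d L1 by (simp add: e_def divide_le_eq algebra_simps)
    finally show ?thesis by simp
  qed
  then have "L h \<le> 0"
    by (rule field_le_epsilon)
  moreover have "0 \<le> L h"
    by (intro pos h)
  ultimately show ?thesis by simp
qed

text \<open>With \<open>u\<close> and \<open>v\<close> half the two square roots,
  \<open>u\<^sup>2 + v\<^sup>2 = 1\<close>, so \<open>2 powr p\<close> can be spread over the two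
  terms. What remains is to compare \<open>u powr p\<close> with \<open>u powr 2\<close> for
  \<open>u\<close> strictly between 0 and 1, and likewise for \<open>v\<close>; the outcome depends
  only on the sign of \<open>2 - p\<close>.\<close>

lemma powr_defect_sign:
  fixes p t :: real
  assumes p: "0 < p" "p \<noteq> 2" and t: "0 < t" "t < 4"
  shows "0 < sgn (2 - p) * (sqrt t powr p + sqrt (4 - t) powr p - 2 powr p)"
proof -
  define u where "u = sqrt t / 2"
  define v where "v = sqrt (4 - t) / 2"
  have uv: "u\<^sup>2 + v\<^sup>2 = 1"
    using t by (simp add: u_def v_def power_divide field_simps)
  have u: "0 < u" "u < 1" and v: "0 < v" "v < 1"
    using t real_sqrt_less_mono[of t 4] real_sqrt_less_mono[of "4 - t" 4] by (simp_all add: u_def v_def)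
  have "sqrt t = 2 * u" "sqrt (4 - t) = 2 * v"
    by (simp_all add: u_def v_def)
  then have eq: "sqrt t powr p + sqrt (4 - t) powr p - 2 powr p =
      2 powr p * (u powr p + v powr p - (u powr 2 + v powr 2))"
    using u v uv by (simp add: powr_mult algebra_simps)
  consider "p < 2" | "2 < p"
    using p by linarith
  then show ?thesis
  proof cases
    case 1
    then have "0 < u powr p + v powr p - (u powr 2 + v powr 2)"
      using powr_less_mono'[OF u 1] powr_less_mono'[OF v 1] by linarith
    then show ?thesis
      unfolding eq using 1 by (simp add: zero_less_mult_iff del: powr_numeral)
  next
    case 2
    then have "u powr p + v powr p - (u powr 2 + v powr 2) < 0"
      using powr_less_mono'[OF u 2] powr_less_mono'[OF v 2] by linarith
    then show ?thesis
      unfolding eq using 2 by (simp add: mult_less_0_iff del: powr_numeral)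
  qed
qed

text \<open>The square root of \<open>f\<close> yields a self-adjoint element of the algebra whose
  square is \<open>f(A)\<close>, and a state is nonnegative on such squares.\<close>

lemma (in selfadj_Icc) Re_trace_cfc_nonneg:
  assumes \<tau>: "tracial_state (commutant S) \<tau>" and A: "A \<in> commutant S"
    and f: "continuous_on {a..b} f" "\<And>t. t \<in> {a..b} \<Longrightarrow> 0 \<le> f t"
  shows "0 \<le> Re (\<tau> (cfc f A))"
proof -
  let ?B = "cfc (\<lambda>t. sqrt (f t)) A"
  have g: "continuous_on {a..b} (\<lambda>t. sqrt (f t))"
    by (intro continuous_intros f)
  have "adj ?B o\<^sub>L ?B = cfc (\<lambda>t. sqrt (f t) * sqrt (f t)) A"
    unfolding adj_selfadj[OF selfadj_cfc[OF g]] cfc_mult[OF g g] ..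
  also have "\<dots> = cfc f A"
    using f(2) by (intro cfc_cong) simp
  finally have "\<tau> (cfc f A) \<in> \<real>\<^sub>\<ge>\<^sub>0"
    using \<tau> commutant_cfc[OF g A] unfolding tracial_state_def by metis
  then show ?thesis
    by (simp add: complex_nonneg_Reals_iff)
qed

text \<open>With \<open>f(A)\<close> in the role of \<open>adj X o\<^sub>L X\<close>, the left side
  is the operator whose trace \<open>pnorm\<close> takes at \<open>X\<close>; the right side is a
  single calculus in \<open>A\<close>.\<close>

lemma (in selfadj_Icc) cfc_powr_sqrt:
  assumes f: "continuous_on {a..b} f" "\<And>t. t \<in> {a..b} \<Longrightarrow> 0 \<le> f t" and p: "0 < p"
  shows "cfc (\<lambda>s. s powr p) (cfc sqrt (cfc f A)) = cfc (\<lambda>t. sqrt (f t) powr p) A"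
proof -
  have "compact (f ` {a..b})"
    using f(1) by (intro compact_continuous_image) simp_all
  then obtain M where M: "\<And>t. t \<in> {a..b} \<Longrightarrow> \<bar>f t\<bar> \<le> M"
    using compact_imp_bounded[of "f ` {a..b}"] unfolding bounded_real by blast
  have "f ` {a..b} \<subseteq> {0..M}"
    using f(2) M by (simp add: image_subset_iff abs_le_iff)
  then have "cfc sqrt (cfc f A) = cfc (\<lambda>t. sqrt (f t)) A"
    by (rule cfc_cfc[OF f(1)]) (intro continuous_intros)
  moreover have "(\<lambda>t. sqrt (f t)) ` {a..b} \<subseteq> {0..sqrt M}"
    using f(2) M by (simp add: image_subset_iff abs_le_iff)
  then have "cfc (\<lambda>s. s powr p) (cfc (\<lambda>t. sqrt (f t)) A) = cfc (\<lambda>t. sqrt (f t) powr p) A"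
    using p by (intro cfc_cfc continuous_intros f continuous_on_powr') auto
  ultimately show ?thesis by simp
qed

theorem lemma2p2:
  fixes N :: "('a::chilbert_space \<Rightarrow>\<^sub>L 'a) set"
    and \<tau> :: "('a \<Rightarrow>\<^sub>L 'a) \<Rightarrow> complex"
    and U :: "'a \<Rightarrow>\<^sub>L 'a"
    and p :: real
  assumes "0 < p" and "p \<noteq> 2"
    and "finite_factor N"
    and "faithful_normal_tracial_state N \<tau>"
    and "U \<in> unitary_group N"
  shows "pnorm \<tau> p (id_blinfun - U) powr p + pnorm \<tau> p (id_blinfun + U) powr p = 2 powr p
           \<longleftrightarrow> U = adj U"
proof -
  define S where "S = commutant N"
  have N: "N = commutant S" and N_adj: "\<And>A. A \<in> N \<Longrightarrow> adj A \<in> N"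
    using assms(3) by (auto simp: finite_factor_def factor_def von_neumann_algebra_def S_def)
  have trace: "tracial_state (commutant S) \<tau>" and faithful: "faithful_state N \<tau>"
    using assms(4) N by (auto simp: faithful_normal_tracial_state_def)
  define V where "V = adj U"
  have U: "U \<in> N" and "V o\<^sub>L U = id_blinfun" "U o\<^sub>L V = id_blinfun"
    using assms(5) by (auto simp: unitary_group_def V_def)
  then have VU [simp]: "blinfun_apply V (blinfun_apply U x) = x"
    and UV [simp]: "blinfun_apply U (blinfun_apply V x) = x" for x
    by (metis blinfun_apply_blinfun_compose blinfun_apply_id_blinfun)+
  have V: "V \<in> N"
    using N_adj[OF U] by (simp add: V_def)
  have cU: "U \<in> cblin" and cV: "V \<in> cblin"
    using U V N by (auto simp: commutant_def)
  have adjU: "cinner (blinfun_apply U x) y = cinner x (blinfun_apply V y)" for x y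
    unfolding V_def by (rule cinner_adj[OF cU])
  have adjV: "cinner (blinfun_apply V x) y = cinner x (blinfun_apply U y)" for x y
    using adjU[of y x] cinner_commute by metis
  have adj_diff: "adj (id_blinfun - U) = id_blinfun - V"
    and adj_sum: "adj (id_blinfun + U) = id_blinfun + V"
    and adj_D: "adj (U - V) = V - U"
    by (auto intro!: adj_eqI simp: blinfun.bilinear_simps cinner_simps adjU adjV)

  \<comment> \<open>Since \<open>U\<close> and \<open>V\<close> are mutually inverse, these products
    are linear in \<open>U\<close> and \<open>V\<close>, and they sum to 4. This is what makes both
    absolute values functions of \<open>H\<close>.\<close>
  define H where "H = (id_blinfun - V) o\<^sub>L (id_blinfun - U)"
  define K where "K = (id_blinfun + V) o\<^sub>L (id_blinfun + U)"
  have H_apply: "blinfun_apply H x = x + x - blinfun_apply U x - blinfun_apply V x" for x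
    by (simp add: H_def blinfun.bilinear_simps)
  have K_apply: "blinfun_apply K x = x + x + blinfun_apply U x + blinfun_apply V x" for x
    by (simp add: K_def blinfun.bilinear_simps)
  have HN: "H \<in> commutant S"
    using U V N unfolding H_def by (auto intro!: commutant_compose commutant_diff commutant_id)
  have saH: "selfadj H"
    using HN by (auto simp: selfadj_def commutant_def H_apply cinner_simps adjU adjV)
  have norm_U: "norm (blinfun_apply U x) = norm x" for x
  proof -
    have "complex_of_real ((norm (blinfun_apply U x))\<^sup>2) = complex_of_real ((norm x)\<^sup>2)"
      using adjU[of x "blinfun_apply U x"] by (simp only: VU cinner_self)
    then have "(norm (blinfun_apply U x))\<^sup>2 = (norm x)\<^sup>2"
      by (simp only: of_real_eq_iff)
    then show ?thesis
      by simp
  qed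
  \<comment> \<open>\<open>U\<close> is isometric, so the squared norms of \<open>x - U x\<close>
    and \<open>x + U x\<close> add up to \<open>4 * (norm x)\<^sup>2\<close>; hence the interval
    from 0 to 4.\<close>
  have Re_H: "Re (cinner (blinfun_apply H x) x) = (norm (x - blinfun_apply U x))\<^sup>2" for x
    using Re_cinner_commute[of x "blinfun_apply U x"] adjV[of x x] norm_U[of x]
    by (simp add: H_apply cinner_simps norm_diff_square cinner_self)
  have Re_K: "4 * (norm x)\<^sup>2 - Re (cinner (blinfun_apply H x) x) = (norm (x + blinfun_apply U x))\<^sup>2" for x
    using Re_cinner_commute[of x "blinfun_apply U x"] adjV[of x x] norm_U[of x]
    by (simp add: H_apply cinner_simps norm_add_square cinner_self)
  interpret H: selfadj_Icc H 0 4
  proof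
    show "spectrum H \<subseteq> complex_of_real ` {0..4}"
    proof (rule selfadj_spectrum_Icc[OF saH])
      show "0 * (norm x)\<^sup>2 \<le> Re (cinner (blinfun_apply H x) x)" for x
        by (simp add: Re_H)
      show "Re (cinner (blinfun_apply H x) x) \<le> 4 * (norm x)\<^sup>2" for x
        using Re_K[of x] zero_le_power2[of "norm (x + blinfun_apply U x)"] by linarith
    qed
  qed (rule saH)

  have K: "cfc (\<lambda>t. 4 - t) H = K"
  proof -
    have "poly [:4, - 1:] = (\<lambda>t :: real. 4 - t)"
      by (simp add: fun_eq_iff)
    moreover have "op_poly [:4, - 1:] H = K"
    proof (rule blinfun_eqI)
      fix x :: 'a
      have "4 *\<^sub>R x = x + x + (x + x)"
        using scaleR_add_left[of 2 2 x] by (simp add: scaleR_2)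
      then show "blinfun_apply (op_poly [:4, - 1:] H) x = blinfun_apply K x"
        by (simp add: blinfun.bilinear_simps H_apply K_apply)
    qed
    ultimately show ?thesis
      using H.cfc_poly[of "[:4, - 1:]"] by simp
  qed

  define L where "L f = Re (\<tau> (cfc f H))" for f
  have L_add: "L (\<lambda>t. f t + g t) = L f + L g"
    if "continuous_on {0..4} f" "continuous_on {0..4} g" for f g
    using that trace H.commutant_cfc[OF _ HN] by (simp add: L_def H.cfc_add tracial_state_def)
  have L_cmult: "L (\<lambda>t. c * f t) = c * L f" if f: "continuous_on {0..4} f" for c f
  proof -
    have "\<tau> (scalar_op (of_real c) o\<^sub>L cfc f H) = of_real c * \<tau> (cfc f H)"
      using trace H.commutant_cfc[OF f HN] unfolding tracial_state_def by blast
    then show ?thesis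
      by (simp add: L_def H.cfc_cmult[OF f] scalar_op_compose_of_real)
  qed
  have L_pos: "0 \<le> L f" if "continuous_on {0..4} f" "\<And>t. t \<in> {0..4} \<Longrightarrow> 0 \<le> f t" for f
    unfolding L_def by (rule H.Re_trace_cfc_nonneg[OF trace HN that])
  have L_1: "L (\<lambda>t. 1) = 1"
    using trace by (simp add: L_def H.cfc_const tracial_state_def)

  define f where "f t = sqrt t powr p" for t
  define g where "g t = sqrt (4 - t) powr p" for t
  have f: "continuous_on {0..4} f" and g: "continuous_on {0..4} g"
    unfolding f_def g_def using assms(1)
    by (auto intro!: continuous_intros continuous_on_powr')
  \<comment> \<open>The outer powers in \<open>pnorm\<close> cancel since \<open>L h\<close> is
    nonnegative; the case \<open>L h = 0\<close> is covered by \<open>0 powr x = 0\<close>.\<close>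
  have pow: "(L h powr (1 / p)) powr p = L h"
    if "continuous_on {0..4} h" "\<And>t. t \<in> {0..4} \<Longrightarrow> 0 \<le> h t" for h
    using assms(1) L_pos[OF that] by (simp add: powr_powr)
  have "cfc (\<lambda>s. s powr p) (abs_op (id_blinfun - U)) = cfc f H"
    using H.cfc_powr_sqrt[of "\<lambda>t. t" p] assms(1)
    by (simp add: abs_op_def adj_diff H.cfc_ident f_def[abs_def] flip: H_def)
  then have norm_minus: "pnorm \<tau> p (id_blinfun - U) powr p = L f"
    using pow[OF f] by (simp add: pnorm_def L_def f_def)
  have "cfc (\<lambda>s. s powr p) (abs_op (id_blinfun + U)) = cfc g H"
    using H.cfc_powr_sqrt[of "\<lambda>t. 4 - t" p] assms(1)
    by (simp add: abs_op_def adj_sum K g_def[abs_def] continuous_intros flip: K_def)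
  then have norm_plus: "pnorm \<tau> p (id_blinfun + U) powr p = L g"
    using pow[OF g] by (simp add: pnorm_def L_def g_def)

  define h where "h t = sgn (2 - p) * (f t + g t + (- (2 powr p)) * 1)" for t
  define w where "w t = t * (4 - t)" for t :: real
  have h: "continuous_on {0..4} h" and w: "continuous_on {0..4} w"
    unfolding h_def w_def by (intro continuous_intros f g)+
  have w_pos: "0 \<le> w t" if "t \<in> {0..4}" for t
    using that by (simp add: w_def)
  \<comment> \<open>At each endpoint one power is \<open>0 powr p = 0\<close> and the other is
    \<open>sqrt 4 powr p = 2 powr p\<close>.\<close>
  have h_ends: "h 0 = 0" "h 4 = 0"
    using assms(1) by (simp_all add: h_def f_def g_def)
  have h_inner: "0 < h t" if "0 < t" "t < 4" for t
    using powr_defect_sign[OF assms(1,2) that] by (simp add: h_def f_def g_def)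
  have h_pos: "0 \<le> h t" if "t \<in> {0..4}" for t
    using that h_ends h_inner[of t] by (cases "t = 0 \<or> t = 4") auto
  have h_zero: "h t = 0 \<longleftrightarrow> w t = 0" if "t \<in> {0..4}" for t
    using that h_ends h_inner[of t] by (cases "t = 0 \<or> t = 4") (auto simp: w_def)
  have "L h = sgn (2 - p) * L (\<lambda>t. f t + g t + (- (2 powr p)) * 1)"
    unfolding h_def by (intro L_cmult continuous_intros f g)
  also have "L (\<lambda>t. f t + g t + (- (2 powr p)) * 1) = L f + L g - 2 powr p"
    using L_add[OF continuous_on_add[OF f g], of "\<lambda>t. (- (2 powr p)) * 1"] L_add[OF f g]
      L_cmult[of "\<lambda>t. 1" "- (2 powr p)"] L_1 by simp
  finally have "L f + L g = 2 powr p \<longleftrightarrow> L h = 0"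
    using assms(2) by (simp add: sgn_zero_iff)
  also have "\<dots> \<longleftrightarrow> L w = 0"
    using positive_functional_zero[where L = L, OF L_add L_cmult L_pos h h_pos w w_pos]
      positive_functional_zero[where L = L, OF L_add L_cmult L_pos w w_pos h h_pos] h_zero by blast
  also have "\<dots> \<longleftrightarrow> U = V"
  proof -
    have "cfc w H = H o\<^sub>L K"
      unfolding w_def by (subst H.cfc_mult) (auto intro!: continuous_intros simp: H.cfc_ident K)
    \<comment> \<open>Both products expand to \<open>2 - U^2 - V^2\<close>, because \<open>U\<close>
      and \<open>V\<close> are mutually inverse.\<close>
    also have "\<dots> = adj (U - V) o\<^sub>L (U - V)"
      unfolding adj_D
      by (rule blinfun_eqI) (simp add: H_apply K_apply blinfun.bilinear_simps)
    finally have w_eq: "cfc w H = adj (U - V) o\<^sub>L (U - V)" .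
    have D: "U - V \<in> N"
      using U V N commutant_diff by blast
    \<comment> \<open>\<open>L\<close> records only the real part; membership in the nonnegative
      reals turns \<open>L w = 0\<close> into vanishing of \<open>\<tau>\<close> itself, as
      faithfulness requires.\<close>
    then have "\<tau> (cfc w H) \<in> \<real>\<^sub>\<ge>\<^sub>0"
      using trace unfolding w_eq N tracial_state_def by blast
    then have "L w = 0 \<longleftrightarrow> \<tau> (adj (U - V) o\<^sub>L (U - V)) = 0"
      by (simp add: L_def w_eq complex_nonneg_Reals_iff complex_eq_iff)
    also have "\<dots> \<longleftrightarrow> U - V = 0"
    proof
      assume "U - V = 0"
      \<comment> \<open>The value of \<open>\<tau>\<close> at 0 comes from homogeneity with the
        scalar 0.\<close>
      then have "\<tau> (adj (U - V) o\<^sub>L (U - V)) = \<tau> (scalar_op 0 o\<^sub>L id_blinfun)"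
        by simp
      also have "\<dots> = 0 * \<tau> id_blinfun"
        using trace commutant_id unfolding tracial_state_def by blast
      finally show "\<tau> (adj (U - V) o\<^sub>L (U - V)) = 0"
        by simp
    qed (use faithful D in \<open>auto simp: faithful_state_def\<close>)
    finally show ?thesis by simp
  qed
  finally show ?thesis
    by (simp add: norm_minus norm_plus V_def)
qed

end
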